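(* Fix $\epsilon>0$ and a Følner sequence $\Phi$ on $\mathbb{N}$. Let $f_{\mathsf{Bes}}\in\mathsf{Bes}(\mathbb{N},\Phi)$ be bounded and non-negative, let $f_{\mathsf{anti}}\in\mathsf{Bes}(\mathbb{N},\Phi)^\perp$ be bounded and real-valued, and let $f_{\mathsf{c}}\in L^2(\mathbb{N},\Phi)$ be bounded, non-negative and compact along $\Phi$. Then there exist a subsequence $\Psi$ of $\Phi$ and an ultrafilter $\mathfrak{p}$ on $\mathbb{N}$ such that: (U1) $\overline{\mathsf{d}}_\Psi(E)>0$ for all $E\in\mathfrak{p}$; (U2) $\{n\in\mathbb{N}: \|\mathsf{R}^nf_{\mathsf{c}}-f_{\mathsf{c}}\|_\Psi<\epsilon/3\}\in\mathfrak{p}$; (U3) $\|\mathsf{R}^{\mathfrak{p}}f_{\mathsf{Bes}}-f_{\mathsf{Bes}}\|_\Psi<\epsilon/3$; (U4) $\langle f_{\mathsf{c}},\mathsf{R}^{\mathfrak{p}}f_{\mathsf{anti}}\rangle_\Psi$ is non-negative.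
   Context: A Følner sequence in $\mathbb{N}$ is a sequence $\Phi\colon N\mapsto\Phi_N$ of finite non-empty subsets of $\mathbb{N}$ with $|(\Phi_N+m)\triangle\Phi_N|/|\Phi_N|\to0$ for all $m\in\mathbb{N}$. $\overline{\mathsf{d}}_\Psi(E)=\limsup_N|E\cap\Psi_N|/|\Psi_N|$. $\|f\|_\Phi=\big(\limsup_{N\to\infty}\frac{1}{|\Phi_N|}\sum_{n\in\Phi_N}|f(n)|^2\big)^{1/2}$, $L^2(\mathbb{N},\Phi)=\{f:\|f\|_\Phi<\infty\}$, $\langle f,h\rangle_\Phi=\lim_{N\to\infty}\frac{1}{|\Phi_N|}\sum_{n\in\Phi_N}f(n)\overline{h(n)}$ when the limit exists. $(\mathsf{R}^mf)(n)=f(n+m)$ and for an ultrafilter $\mathfrak{p}$ and bounded $f$, $(\mathsf{R}^{\mathfrak{p}}f)(n)=\lim_{m\to\mathfrak{p}}f(n+m)$ (ultrafilter limit). A trigonometric polynomial is $n\mapsto\sum_{j=1}^Jc_je^{2\pi i\theta_jn}$ ($c_j\in\mathbb{C}$, $\theta_j\in[0,1)$); $\mathsf{Bes}(\mathbb{N},\Phi)$ is the set of $f$ that can be approximated arbitrarily well in $\|\cdot\|_\Phi$ by trigonometric polynomials; $\mathsf{Bes}(\mathbb{N},\Phi)^\perp$ is the set of $f\in L^2(\mathbb{N},\Phi)$ with $\lim_{N}\frac{1}{|\Phi_N|}\sum_{n\in\Phi_N}f(n)e^{2\pi in\theta}=0$ for all $\theta\in[0,1)$. $f\in L^2(\mathbb{N},\Phi)$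 is compact along $\Phi$ if for every $\delta>0$ there is $K$ with $\min_{1\le k\le K}\|\mathsf{R}^mf-\mathsf{R}^kf\|_\Phi<\delta$ for all $m\in\mathbb{N}$. *)

theory Defs
  imports "HOL-Analysis.Analysis"
begin

text \<open>Here the natural numbers are the Isabelle type nat (including 0).
Functions N -> C are represented as nat => complex.\<close>

definition folner :: "(nat \<Rightarrow> nat set) \<Rightarrow> bool" where
  "folner \<Phi> \<longleftrightarrow> (\<forall>N. finite (\<Phi> N) \<and> \<Phi> N \<noteq> {}) \<and>
     (\<forall>m. (\<lambda>N. real (card (((\<lambda>n. n + m) ` \<Phi> N) \<union> \<Phi> N - ((\<lambda>n. n + m) ` \<Phi> N) \<inter> \<Phi> N))
                 / real (card (\<Phi> N))) \<longlonglongrightarrow> 0)"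

definition subseq_of :: "(nat \<Rightarrow> nat set) \<Rightarrow> (nat \<Rightarrow> nat set) \<Rightarrow> bool" where
  "subseq_of \<Psi> \<Phi> \<longleftrightarrow> (\<exists>\<sigma>. strict_mono \<sigma> \<and> \<Psi> = \<Phi> \<circ> \<sigma>)"

definition avg :: "(nat \<Rightarrow> nat set) \<Rightarrow> (nat \<Rightarrow> 'a::real_normed_field) \<Rightarrow> nat \<Rightarrow> 'a" where
  "avg \<Phi> f N = (\<Sum>n\<in>\<Phi> N. f n) / of_nat (card (\<Phi> N))"

definition upper_density :: "(nat \<Rightarrow> nat set) \<Rightarrow> nat set \<Rightarrow> ereal" where
  "upper_density \<Psi> E = limsup (\<lambda>N. ereal (real (card (E \<inter> \<Psi> N)) / real (card (\<Psi> N))))"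

definition sqnorm :: "(nat \<Rightarrow> nat set) \<Rightarrow> (nat \<Rightarrow> complex) \<Rightarrow> ereal" where
  "sqnorm \<Phi> f = limsup (\<lambda>N. ereal (avg \<Phi> (\<lambda>n. (cmod (f n))\<^sup>2) N))"

definition phinorm :: "(nat \<Rightarrow> nat set) \<Rightarrow> (nat \<Rightarrow> complex) \<Rightarrow> ereal" where
  "phinorm \<Phi> f = (if sqnorm \<Phi> f = \<infinity> then \<infinity> else ereal (sqrt (real_of_ereal (sqnorm \<Phi> f))))"

definition L2 :: "(nat \<Rightarrow> nat set) \<Rightarrow> (nat \<Rightarrow> complex) set" where
  "L2 \<Phi> = {f. phinorm \<Phi> f < \<infinity>}"

definition shift :: "nat \<Rightarrow> (nat \<Rightarrow> 'a) \<Rightarrow> nat \<Rightarrow> 'a" where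
  "shift m f n = f (n + m)"

definition trig_poly :: "(nat \<Rightarrow> complex) \<Rightarrow> bool" where
  "trig_poly P \<longleftrightarrow> (\<exists>J c \<theta>. (\<forall>j<J. 0 \<le> \<theta> j \<and> \<theta> j < 1) \<and>
      P = (\<lambda>n. \<Sum>j<(J::nat). c j * exp (2 * pi * \<i> * complex_of_real (\<theta> j) * of_nat n)))"

definition Bes :: "(nat \<Rightarrow> nat set) \<Rightarrow> (nat \<Rightarrow> complex) set" where
  "Bes \<Phi> = {f. \<forall>\<delta>>0. \<exists>P. trig_poly P \<and> phinorm \<Phi> (\<lambda>n. f n - P n) < ereal \<delta>}"

definition Bes_perp :: "(nat \<Rightarrow> nat set) \<Rightarrow> (nat \<Rightarrow> complex) set" where
  "Bes_perp \<Phi> = {f \<in> L2 \<Phi>. \<forall>\<theta>::real. 0 \<le> \<theta> \<and> \<theta> < 1 \<longrightarrow>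
      (avg \<Phi> (\<lambda>n. f n * exp (2 * pi * \<i> * of_nat n * complex_of_real \<theta>))) \<longlonglongrightarrow> 0}"

definition compact_along :: "(nat \<Rightarrow> nat set) \<Rightarrow> (nat \<Rightarrow> complex) \<Rightarrow> bool" where
  "compact_along \<Phi> f \<longleftrightarrow> f \<in> L2 \<Phi> \<and>
     (\<forall>\<delta>>0. \<exists>K. \<forall>m. \<exists>k\<in>{1..K}. phinorm \<Phi> (\<lambda>n. shift m f n - shift k f n) < ereal \<delta>)"

definition ultrafilter :: "nat filter \<Rightarrow> bool" where
  "ultrafilter F \<longleftrightarrow> F \<noteq> bot \<and> (\<forall>E. eventually (\<lambda>n. n \<in> E) F \<or> eventually (\<lambda>n. n \<notin> E) F)"

definition ushift :: "nat filter \<Rightarrow> (nat \<Rightarrow> real) \<Rightarrow> nat \<Rightarrow> real" where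
  "ushift p f n = Lim p (\<lambda>m. f (n + m))"

end

theory Submission
  imports Defs
begin

text \<open>Fix a nonprincipal ultrafilter \<open>q\<close> and the mean \<open>L u = lim\<^sub>q\<close> of the averages of \<open>u\<close> along \<open>\<Phi>\<close>.
  By Bogolyubov's lemma the \<open>\<epsilon>/3\<close>-return times of the compact function contain a Bohr set; let \<open>w \<ge> 0\<close> be a
  continuous weight supported on a smaller Bohr set on which moreover a trigonometric polynomial close to
  \<open>fBes\<close> is almost periodic. As \<open>w\<close> is a uniform limit of trigonometric polynomials, \<open>L (w R\<^sup>n fanti) = 0\<close> for
  all \<open>n\<close>, so \<open>A\<^sub>N m = avg\<^sub>N (fc \<cdot> R\<^sup>m fanti)\<close> has \<open>w\<close>-weighted mean zero in \<open>m\<close>, for every \<open>N\<close>; and the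
  weighted mass of the \<open>m\<close> for which \<open>R\<^sup>m fBes\<close> is far from \<open>fBes\<close> on \<open>\<Phi> N\<close> tends to zero. A Fatou-type
  argument for the finitely additive mean then yields decreasing sets \<open>E\<^sub>i\<close> of positive mass and indices
  \<open>N\<^sub>i \<rightarrow> \<infinity>\<close> such that on \<open>E\<^sub>i\<close> the values of \<open>A\<close> at \<open>N\<^sub>i\<close> are at least \<open>-1/(i+1)\<close> and nearly constant, the
  second condition is satisfied at \<open>N\<^sub>i\<close>, and each \<open>E\<^sub>i\<close> keeps density bounded below along the later \<open>N\<^sub>k\<close>.
  Passing to a subsequence along which the values converge, any ultrafilter containing all \<open>E\<^sub>i\<close> and the
  complements of all sets of density zero works.\<close>

section \<open>Ultrafilters\<close>

text \<open>By Zorn's lemma there is a minimal nontrivial filter below \<open>F\<close>: a chain of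
  such filters has a nontrivial infimum, because an event of the infimum already belongs to a
  member. Minimality decides every \<open>E\<close>, since the meet with \<open>principal E\<close>
  is either \<open>bot\<close> or the filter itself.\<close>

lemma ultrafilter_refines:
  fixes F :: "nat filter"
  assumes "F \<noteq> bot"
  obtains U where "ultrafilter U" "U \<le> F"
proof -
  let ?A = "{G. G \<noteq> bot \<and> G \<le> F}"
  have "\<exists>U\<in>?A. \<forall>G\<in>?A. G \<le> U \<longrightarrow> G = U"
  proof (rule predicate_Zorn)
    show "partial_order_on ?A (relation_of (\<lambda>G H. H \<le> G) ?A)"
      by (rule partial_order_on_relation_ofI) auto
    fix C assume C: "C \<in> Chains (relation_of (\<lambda>G H. H \<le> G) ?A)"
    show "\<exists>U\<in>?A. \<forall>G\<in>C. U \<le> G"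
    proof (cases "C = {}")
      case True
      with assms show ?thesis by auto
    next
      case False
      have CA: "C \<subseteq> ?A" and lin: "\<And>G H. G \<in> C \<Longrightarrow> H \<in> C \<Longrightarrow> G \<le> H \<or> H \<le> G"
        using C by (auto simp: Chains_def relation_of_def)
      have "eventually P (Inf C) \<longleftrightarrow> (\<exists>G\<in>C. eventually P G)" for P
        using lin False by (intro eventually_Inf_base) (metis inf.absorb1 inf.absorb2 order_refl)+
      then have "Inf C \<noteq> bot"
        using CA by (auto simp: trivial_limit_def)
      moreover have "Inf C \<le> F"
        using False CA by (metis (mono_tags, lifting) Inf_lower2 all_not_in_conv mem_Collect_eq subsetD)
      ultimately show ?thesis
        by (auto intro: Inf_lower)
    qed
  qed
  then obtain U where U: "U \<noteq> bot" "U \<le> F" and max: "\<And>G. G \<noteq> bot \<Longrightarrow> G \<le> U \<Longrightarrow> G = U"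
    by (auto dest: order_trans)
  have "eventually (\<lambda>n. n \<in> E) U \<or> eventually (\<lambda>n. n \<notin> E) U" for E
  proof (cases "inf U (principal E) = bot")
    case True
    then show ?thesis by (simp add: trivial_limit_def eventually_inf_principal)
  next
    case False
    from max[OF this] have "U \<le> principal E" by (metis inf.cobounded2 inf_le1)
    then show ?thesis by (simp add: le_principal)
  qed
  then show ?thesis using U that unfolding ultrafilter_def by blast
qed

text \<open>Compactness of the closed range gives a cluster point, and the dichotomy of an
  ultrafilter upgrades it to a limit. Hence \<open>Lim p\<close> of a bounded sequence is a genuine
  limit.\<close>

lemma ultrafilter_tendsto_bounded:
  fixes u :: "nat \<Rightarrow> real"
  assumes p: "ultrafilter p" and u: "bounded (range u)"
  shows "(u \<longlongrightarrow> Lim p u) p"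
proof -
  have p0: "p \<noteq> bot" and dich: "\<And>E. eventually (\<lambda>n. n \<in> E) p \<or> eventually (\<lambda>n. n \<notin> E) p"
    using p by (auto simp: ultrafilter_def)
  have "compact (closure (range u))" using u by simp
  moreover have "filtermap u p \<noteq> bot" using p0 by (simp add: filtermap_bot_iff)
  moreover have "eventually (\<lambda>x. x \<in> closure (range u)) (filtermap u p)"
    by (auto simp: eventually_filtermap intro!: always_eventually subsetD[OF closure_subset])
  ultimately obtain l where l: "inf (nhds l) (filtermap u p) \<noteq> bot"
    unfolding compact_filter by blast
  have "(u \<longlongrightarrow> l) p"
  proof (rule topological_tendstoI, rule ccontr)
    fix S assume S: "open S" "l \<in> S" "\<not> (\<forall>\<^sub>F x in p. u x \<in> S)"
    then have "\<forall>\<^sub>F x in p. u x \<notin> S" using dich[of "{x. u x \<in> S}"] by simp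
    then have "\<forall>\<^sub>F x in filtermap u p. x \<notin> S" by (simp add: eventually_filtermap)
    moreover have "\<forall>\<^sub>F x in nhds l. x \<in> S" using S by (simp add: eventually_nhds) blast
    ultimately have "\<forall>\<^sub>F x in inf (nhds l) (filtermap u p). False"
      unfolding eventually_inf by blast
    with l show False by (simp add: trivial_limit_def)
  qed
  then show ?thesis by (metis p0 tendsto_Lim)
qed

section \<open>Bogolyubov's lemma for colourings\<close>

text \<open>Orthogonality of the characters of the integers modulo \<open>M\<close>: a geometric sum
  whose ratio is an \<open>M\<close>-th root of unity other than 1.\<close>

lemma sum_cis_eq_0:
  fixes d :: int
  assumes "M > 0" "\<not> int M dvd d"
  shows "(\<Sum>\<xi><M. cis (of_int d * (2 * pi * real \<xi> / M))) = 0"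
proof -
  let ?z = "cis (2 * pi * d / M)"
  have "?z \<noteq> 1"
  proof
    assume "?z = 1"
    then have "exp (\<i> * of_real (2 * pi * d / M)) = 1" by (simp add: cis_conv_exp)
    then obtain k :: int where "2 * pi * d / M = of_int (2 * k) * pi"
      by (auto simp: exp_eq_1)
    then have "real_of_int d = real_of_int (k * int M)"
      using assms by (simp add: field_simps)
    then have "d = k * int M" by (simp only: of_int_eq_iff)
    with assms show False by simp
  qed
  moreover have "?z ^ M = 1"
  proof -
    have "?z ^ M = cis (2 * pi * of_int d)" using assms by (simp add: Complex.DeMoivre)
    also have "\<dots> = 1" by (rule cis_multiple_2pi) simp
    finally show ?thesis .
  qed
  moreover have "(\<Sum>\<xi><M. cis (of_int d * (2 * pi * real \<xi> / M))) = (\<Sum>\<xi><M. ?z ^ \<xi>)"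
    by (intro sum.cong) (auto simp: Complex.DeMoivre algebra_simps)
  ultimately show ?thesis by (simp add: sum_gp_strict)
qed

text \<open>Expanding the square and summing over the frequencies first leaves only the diagonal,
  since distinct elements of \<open>{..<M}\<close> are incongruent modulo \<open>M\<close>.\<close>

lemma parseval_cis:
  fixes S :: "nat set"
  assumes "S \<subseteq> {..<M}"
  shows "(\<Sum>\<xi><M. (cmod (\<Sum>s\<in>S. cis (real s * (2 * pi * real \<xi> / M))))\<^sup>2) = real M * card S"
proof (cases "M = 0")
  case False
  have fin: "finite S" using assms finite_subset by blast
  have diff: "real s * x + - (real t * x) = of_int (int s - int t) * x" for s t x
    by (simp add: algebra_simps)
  have "complex_of_real (\<Sum>\<xi><M. (cmod (\<Sum>s\<in>S. cis (real s * (2 * pi * real \<xi> / M))))\<^sup>2)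
      = (\<Sum>\<xi><M. \<Sum>s\<in>S. \<Sum>t\<in>S. cis (of_int (int s - int t) * (2 * pi * real \<xi> / M)))"
    by (simp only: of_real_sum complex_norm_square cnj_sum sum_product cis_cnj cis_mult)
       (simp only: diff)
  also have "\<dots> = (\<Sum>s\<in>S. \<Sum>t\<in>S. \<Sum>\<xi><M. cis (of_int (int s - int t) * (2 * pi * real \<xi> / M)))"
    by (subst sum.swap, rule sum.cong[OF refl], rule sum.swap)
  also have "\<dots> = (\<Sum>s\<in>S. \<Sum>t\<in>S. if s = t then of_nat M else 0)"
  proof (intro sum.cong refl)
    fix s t assume st: "s \<in> S" "t \<in> S"
    show "(\<Sum>\<xi><M. cis (of_int (int s - int t) * (2 * pi * real \<xi> / M))) = (if s = t then of_nat M else 0)"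
    proof (cases "s = t")
      case False
      have "s < M" "t < M" using st assms by auto
      then have "\<bar>int s - int t\<bar> < int M" by linarith
      then have "\<not> int M dvd (int s - int t)"
        using False zdvd_imp_le[of "int M" "\<bar>int s - int t\<bar>"] by fastforce
      with False sum_cis_eq_0[of M "int s - int t"] \<open>M \<noteq> 0\<close> show ?thesis by simp
    qed auto
  qed
  also have "\<dots> = complex_of_real (real M * card S)"
    using fin by simp
  finally show ?thesis by (simp only: of_real_eq_iff)
qed (use assms in auto)

text \<open>The sum is the real part of a Fourier count of the solutions of
  \<open>a + b = r + c + d\<close>. The modulus \<open>4*n\<close> exceeds the absolute value of
  every \<open>a + b - c - d - r\<close>, so a congruence would be an equality and no term
  survives.\<close>

lemma fourth_moment_vanishes:
  fixes S :: "nat set"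
  assumes S: "S \<subseteq> {..<n}" and r: "r < n"
    and no: "\<And>a b c d. a \<in> S \<Longrightarrow> b \<in> S \<Longrightarrow> c \<in> S \<Longrightarrow> d \<in> S \<Longrightarrow> a + b \<noteq> r + c + d"
  shows "(\<Sum>\<xi><4*n. (cmod (\<Sum>s\<in>S. cis (real s * (2 * pi * real \<xi> / real (4*n))))) ^ 4 * cos (real r * (2 * pi * real \<xi> / real (4*n)))) = 0"
proof -
  define F where "F \<xi> = (\<Sum>s\<in>S. cis (real s * (2 * pi * real \<xi> / real (4*n))))" for \<xi>
  let ?e = "\<lambda>a b c d \<xi>. cis (of_int (int a + int b - int c - int d - int r) * (2 * pi * real \<xi> / real (4*n)))"
  have comb: "real a * x + - (real c * x) + (real b * x + - (real d * x)) + - (real r * x)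
      = of_int (int a + int b - int c - int d - int r) * x" for a b c d x
    by (simp add: algebra_simps)
  have F4: "F \<xi> * cnj (F \<xi>) * (F \<xi> * cnj (F \<xi>)) * cis (- (real r * (2 * pi * real \<xi> / real (4*n))))
      = (\<Sum>a\<in>S. \<Sum>b\<in>S. \<Sum>c\<in>S. \<Sum>d\<in>S. ?e a b c d \<xi>)" for \<xi>
    unfolding F_def cnj_sum sum_product unfolding sum_distrib_right cis_cnj cis_mult
    by (intro sum.cong refl arg_cong[of _ _ cis])
       (rule comb)
  have swap: "(\<Sum>\<xi><4*n. \<Sum>a\<in>S. \<Sum>b\<in>S. \<Sum>c\<in>S. \<Sum>d\<in>S. ?e a b c d \<xi>)
      = (\<Sum>a\<in>S. \<Sum>b\<in>S. \<Sum>c\<in>S. \<Sum>d\<in>S. \<Sum>\<xi><4*n. ?e a b c d \<xi>)"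
    by (subst sum.swap, rule sum.cong[OF refl], subst sum.swap, rule sum.cong[OF refl],
        subst sum.swap, rule sum.cong[OF refl], rule sum.swap)
  have "(\<Sum>\<xi><4*n. ?e a b c d \<xi>) = 0" if "a \<in> S" "b \<in> S" "c \<in> S" "d \<in> S" for a b c d
  proof (rule sum_cis_eq_0)
    show "0 < 4 * n" using r by simp
    have lt: "a < n" "b < n" "c < n" "d < n" using that S by auto
    have ne: "int a + int b - int c - int d - int r \<noteq> 0" using no[of a b c d] that by linarith
    moreover have "\<bar>int a + int b - int c - int d - int r\<bar> < int (4 * n)"
      using lt r by linarith
    ultimately show "\<not> int (4 * n) dvd int a + int b - int c - int d - int r"
      using zdvd_imp_le[of "int (4*n)" "\<bar>int a + int b - int c - int d - int r\<bar>"] by fastforce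
  qed
  then have z: "(\<Sum>\<xi><4*n. F \<xi> * cnj (F \<xi>) * (F \<xi> * cnj (F \<xi>)) * cis (- (real r * (2 * pi * real \<xi> / real (4*n))))) = 0"
    unfolding F4 swap by simp
  have "F \<xi> * cnj (F \<xi>) * (F \<xi> * cnj (F \<xi>)) = complex_of_real ((cmod (F \<xi>)) ^ 4)" for \<xi>
  proof -
    have "F \<xi> * cnj (F \<xi>) = complex_of_real ((cmod (F \<xi>))\<^sup>2)"
      by (simp only: complex_norm_square)
    then show ?thesis by (simp add: power4_eq_xxxx power2_eq_square)
  qed
  then have "Re (\<Sum>\<xi><4*n. complex_of_real ((cmod (F \<xi>)) ^ 4) * cis (- (real r * (2 * pi * real \<xi> / real (4*n))))) = 0"
    using z by simp
  then show ?thesis by (simp add: F_def)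
qed

text \<open>The frequencies form the large spectrum of \<open>S\<close>, whose size Parseval bounds
  by \<open>32 * K\<^sup>2\<close>. If \<open>r\<close> had no such representation, the fourth
  moment twisted by \<open>r\<close> would be zero; but the frequency 0 contributes
  \<open>card S ^ 4\<close>, the large spectrum a nonnegative amount, and the other frequencies cost
  at most half of \<open>card S ^ 4\<close>.\<close>

lemma bogolyubov_finite:
  fixes S :: "nat set"
  assumes S: "S \<subseteq> {..<n}" and n: "n > 0" and K: "n \<le> card S * K"
  obtains \<theta> :: "nat \<Rightarrow> real" where "\<And>j. 0 \<le> \<theta> j \<and> \<theta> j \<le> 1"
    "\<And>r. r < n \<Longrightarrow> (\<And>j. j < 32 * K\<^sup>2 \<Longrightarrow> cos (real r * (2 * pi * \<theta> j)) \<ge> 0) \<Longrightarrow>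
       \<exists>a\<in>S. \<exists>b\<in>S. \<exists>c\<in>S. \<exists>d\<in>S. a + b = r + c + d"
proof -
  have Kpos: "K > 0" using n K by (cases K) auto
  have cpos: "card S > 0" using n K by (cases "card S") auto
  define f where "f \<xi> = cmod (\<Sum>s\<in>S. cis (real s * (2 * pi * real \<xi> / real (4*n))))" for \<xi> :: nat
  \<comment> \<open>Chosen so that \<open>\<beta>\<close> times the Parseval total
    \<open>4 * n * card S\<close> is at most half of \<open>card S ^ 4\<close>, given
    \<open>n \<le> card S * K\<close>.\<close>
  define \<beta> where "\<beta> = (real (card S))\<^sup>2 / (8 * K)"
  define L where "L = {\<xi>. \<xi> < 4*n \<and> (f \<xi>)\<^sup>2 \<ge> \<beta>}"
  have \<beta>: "\<beta> > 0" using cpos Kpos by (simp add: \<beta>_def)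
  have nK: "real n \<le> real (card S) * K" using K by (metis of_nat_le_iff of_nat_mult)
  have pars: "(\<Sum>\<xi><4*n. (f \<xi>)\<^sup>2) = 4 * real n * card S"
  proof -
    have "S \<subseteq> {..<4*n}" using S by (rule order_trans) auto
    from parseval_cis[OF this] show ?thesis by (simp only: f_def of_nat_mult of_nat_numeral)
  qed
  have finL: "finite L" by (simp add: L_def)
  have "\<beta> * card L \<le> (\<Sum>\<xi>\<in>L. (f \<xi>)\<^sup>2)"
    using sum_bounded_below[of L \<beta> "\<lambda>\<xi>. (f \<xi>)\<^sup>2"] by (simp add: L_def mult.commute)
  also have "\<dots> \<le> (\<Sum>\<xi><4*n. (f \<xi>)\<^sup>2)" by (rule sum_mono2) (auto simp: L_def)
  finally have "\<beta> * card L \<le> 4 * real n * card S" by (simp add: pars)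
  then have "real (card S) * (card S * card L) \<le> real (card S) * (32 * K * n)"
    using Kpos by (simp add: \<beta>_def field_simps power2_eq_square)
  then have "real (card S) * card L \<le> 32 * K * n" using cpos by simp
  also have "\<dots> \<le> 32 * K * (real (card S) * K)" using mult_left_mono[OF nK, of "real (32 * K)"] by simp
  finally have "real (card S) * card L \<le> real (card S) * real (32 * K\<^sup>2)"
    by (simp add: power2_eq_square mult_ac)
  then have cardL: "card L \<le> 32 * K\<^sup>2" using cpos by (simp only: mult_le_cancel_left_pos of_nat_0_less_iff of_nat_le_iff)
  obtain h where h: "bij_betw h {0..<card L} L" using ex_bij_betw_nat_finite[OF finL] by blast
  \<comment> \<open>Padding with the frequency 0 makes the number of conditions depend on
    \<open>K\<close> alone; it imposes nothing, as cos 0 = 1.\<close>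
  define \<theta> where "\<theta> j = (if j < card L then real (h j) / (4*n) else 0)" for j
  show thesis
  proof (rule that)
    have hL: "h j < 4 * n" if "j < card L" for j
      using bij_betwE[OF h] that by (auto simp: L_def)
    show "0 \<le> \<theta> j \<and> \<theta> j \<le> 1" for j
      using hL[of j] n by (auto simp: \<theta>_def divide_simps)
  next
    fix r assume r: "r < n" and cs: "\<And>j. j < 32 * K\<^sup>2 \<Longrightarrow> cos (real r * (2 * pi * \<theta> j)) \<ge> 0"
    have cosL: "cos (real r * (2 * pi * real \<xi> / real (4*n))) \<ge> 0" if "\<xi> \<in> L" for \<xi>
    proof -
      from that h obtain j where "j < card L" "h j = \<xi>" by (metis atLeastLessThan_iff bij_betw_def imageE)
      with cs[of j] cardL show ?thesis by (simp add: \<theta>_def)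
    qed
    show "\<exists>a\<in>S. \<exists>b\<in>S. \<exists>c\<in>S. \<exists>d\<in>S. a + b = r + c + d"
    proof (rule ccontr)
      assume "\<not> ?thesis"
      then have "(\<Sum>\<xi><4*n. f \<xi> ^ 4 * cos (real r * (2 * pi * real \<xi> / real (4*n)))) = 0"
        unfolding f_def by (intro fourth_moment_vanishes S r) blast
      moreover have "(if \<xi> = 0 then real (card S) ^ 4 else 0) - \<beta> * (f \<xi>)\<^sup>2 \<le> f \<xi> ^ 4 * cos (real r * (2 * pi * real \<xi> / real (4*n)))"
        if "\<xi> < 4*n" for \<xi>
      proof -
        have p4: "f \<xi> ^ 4 = (f \<xi>)\<^sup>2 * (f \<xi>)\<^sup>2" by (simp add: power4_eq_xxxx power2_eq_square)
        consider "\<xi> = 0" | "\<xi> \<noteq> 0" "\<xi> \<in> L" | "\<xi> \<noteq> 0" "\<xi> \<notin> L" by blast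
        then show ?thesis
        proof cases
          case 1
          then show ?thesis using \<beta> by (simp add: f_def)
        next
          case 2
          with cosL[of \<xi>] have "f \<xi> ^ 4 * cos (real r * (2 * pi * real \<xi> / real (4*n))) \<ge> 0" by simp
          moreover have "\<beta> * (f \<xi>)\<^sup>2 \<ge> 0" using \<beta> by simp
          ultimately show ?thesis using 2 by simp
        next
          case 3
          then have "(f \<xi>)\<^sup>2 \<le> \<beta>" using that by (auto simp: L_def)
          then have "f \<xi> ^ 4 \<le> \<beta> * (f \<xi>)\<^sup>2" unfolding p4 by (rule mult_right_mono) simp
          moreover have "f \<xi> ^ 4 * (- cos (real r * (2 * pi * real \<xi> / real (4*n)))) \<le> f \<xi> ^ 4 * 1"
            by (intro mult_left_mono) (use cos_ge_minus_one in \<open>auto simp: minus_le_iff\<close>)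
          ultimately show ?thesis using 3 by simp
        qed
      qed
      then have "(\<Sum>\<xi><4*n. (if \<xi> = 0 then real (card S) ^ 4 else 0) - \<beta> * (f \<xi>)\<^sup>2)
          \<le> (\<Sum>\<xi><4*n. f \<xi> ^ 4 * cos (real r * (2 * pi * real \<xi> / real (4*n))))"
        by (intro sum_mono) auto
      moreover have "(\<Sum>\<xi><4*n. (if \<xi> = 0 then real (card S) ^ 4 else 0) - \<beta> * (f \<xi>)\<^sup>2)
         = real (card S) ^ 4 - \<beta> * (4 * real n * card S)"
        using n by (simp add: sum_subtractf pars flip: sum_distrib_left)
      ultimately have "real (card S) ^ 4 \<le> \<beta> * (4 * real n * card S)" by linarith
      also have "\<dots> \<le> \<beta> * (4 * (real (card S) * K) * card S)"
        using nK \<beta> by (intro mult_left_mono mult_right_mono) auto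
      also have "\<dots> = real (card S) ^ 4 / 2"
        using Kpos by (simp add: \<beta>_def field_simps power4_eq_xxxx power2_eq_square)
      finally show False using cpos by simp
    qed
  qed
qed

section \<open>From finite intervals to colourings of all natural numbers\<close>

lemma exists_nonprincipal_ultrafilter:
  obtains q where "ultrafilter q" "q \<le> sequentially"
  using ultrafilter_refines[of sequentially] by auto

text \<open>The frequencies obtained on longer and longer initial segments are passed to the limit along an ultrafilter.\<close>

lemma bogolyubov_colouring:
  fixes c :: "nat \<Rightarrow> nat"
  assumes c: "\<And>m. c m < K"
  shows "\<exists>(J::nat) \<theta>. \<forall>r. (\<forall>j<J. cos (real r * (2 * pi * \<theta> j)) > 0) \<longrightarrow>
       (\<exists>s1 s2 s3 s4. c s2 = c s1 \<and> c s3 = c s1 \<and> c s4 = c s1 \<and> s1 + s2 = r + s3 + s4)"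
proof -
  \<comment> \<open>The number of frequencies depends on \<open>K\<close> and not on
    \<open>n\<close>, so they can be passed to the limit one by one.\<close>
  have "\<exists>\<theta>. (\<forall>j. 0 \<le> \<theta> j \<and> \<theta> j \<le> (1::real)) \<and> (\<forall>r::nat. r < n \<longrightarrow> (\<forall>j<32 * K\<^sup>2. cos (real r * (2 * pi * \<theta> j)) \<ge> 0) \<longrightarrow>
       (\<exists>s1 s2 s3 s4. c s2 = c s1 \<and> c s3 = c s1 \<and> c s4 = c s1 \<and> s1 + s2 = r + s3 + s4))" for n
  proof (cases "n = 0")
    case True
    then show ?thesis by (intro exI[of _ "\<lambda>_. 0"]) auto
  next
    case False
    \<comment> \<open>Pigeonhole: some colour class occupies at least the fraction
      1/\<open>K\<close> of \<open>{..<n}\<close>.\<close>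
    have "\<exists>k<K. n \<le> card {m\<in>{..<n}. c m = k} * K"
    proof (rule ccontr)
      assume "\<not> ?thesis"
      then have lt: "\<And>k. k < K \<Longrightarrow> card {m\<in>{..<n}. c m = k} * K < n" by auto
      have "n = card (\<Union>k\<in>{..<K}. {m\<in>{..<n}. c m = k})"
        by (subst (1) card_lessThan[of n, symmetric], rule arg_cong[of _ _ card]) (use c in auto)
      also have "\<dots> = (\<Sum>k<K. card {m\<in>{..<n}. c m = k})"
        by (rule card_UN_disjoint) auto
      finally have "n * K = (\<Sum>k<K. card {m\<in>{..<n}. c m = k} * K)"
        by (metis sum_distrib_right)
      also have "\<dots> < (\<Sum>k<K. n)"
        using c[of 0] lt by (intro sum_strict_mono) (auto simp: lessThan_empty_iff)
      finally show False by simp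
    qed
    then obtain k where k: "n \<le> card {m\<in>{..<n}. c m = k} * K" by blast
    obtain \<theta> where \<theta>: "\<And>j. 0 \<le> \<theta> j \<and> \<theta> j \<le> (1::real)"
      and rep: "\<And>r. r < n \<Longrightarrow> (\<And>j. j < 32 * K\<^sup>2 \<Longrightarrow> cos (real r * (2 * pi * \<theta> j)) \<ge> 0) \<Longrightarrow>
       \<exists>s1\<in>{m\<in>{..<n}. c m = k}. \<exists>s2\<in>{m\<in>{..<n}. c m = k}. \<exists>s3\<in>{m\<in>{..<n}. c m = k}.
         \<exists>s4\<in>{m\<in>{..<n}. c m = k}. s1 + s2 = r + s3 + s4"
      by (rule bogolyubov_finite[OF _ _ k]) (use False in auto)
    show ?thesis
    proof (intro exI[of _ \<theta>] conjI allI impI)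
      fix r assume "r < n" "\<forall>j<32 * K\<^sup>2. cos (real r * (2 * pi * \<theta> j)) \<ge> 0"
      with rep[of r] obtain s1 s2 s3 s4 where "c s1 = k" "c s2 = k" "c s3 = k" "c s4 = k" "s1 + s2 = r + s3 + s4"
        by blast
      then show "\<exists>s1 s2 s3 s4. c s2 = c s1 \<and> c s3 = c s1 \<and> c s4 = c s1 \<and> s1 + s2 = r + s3 + s4"
        by metis
    qed (use \<theta> in auto)
  qed
  then obtain \<Theta> :: "nat \<Rightarrow> nat \<Rightarrow> real" where \<Theta>: "\<And>n j. 0 \<le> \<Theta> n j \<and> \<Theta> n j \<le> 1"
    and rep: "\<And>n r. r < n \<Longrightarrow> (\<forall>j<32 * K\<^sup>2. cos (real r * (2 * pi * \<Theta> n j)) \<ge> 0) \<Longrightarrow>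
       \<exists>s1 s2 s3 s4. c s2 = c s1 \<and> c s3 = c s1 \<and> c s4 = c s1 \<and> s1 + s2 = r + s3 + s4"
    by metis
  obtain q where q: "ultrafilter q" "q \<le> sequentially" by (rule exists_nonprincipal_ultrafilter)
  have "bounded (range (\<lambda>n. \<Theta> n j))" for j
    by (rule bounded_subset[of "{0..1}"]) (use \<Theta> in auto)
  then have lim: "((\<lambda>n. \<Theta> n j) \<longlongrightarrow> Lim q (\<lambda>n. \<Theta> n j)) q" for j
    by (rule ultrafilter_tendsto_bounded[OF q(1)])
  show ?thesis
  proof (rule exI[of _ "32 * K\<^sup>2"], rule exI[of _ "\<lambda>j. Lim q (\<lambda>n. \<Theta> n j)"], intro allI impI)
    fix r :: nat assume pos: "\<forall>j<32 * K\<^sup>2. cos (real r * (2 * pi * Lim q (\<lambda>n. \<Theta> n j))) > 0"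
    \<comment> \<open>Strict positivity at the limit frequencies is an open condition and so holds
      along \<open>q\<close>; the finite stage asks only for nonnegative cosines.\<close>
    have "\<forall>\<^sub>F n in q. \<forall>j\<in>{..<32 * K\<^sup>2}. cos (real r * (2 * pi * \<Theta> n j)) > 0"
    proof (rule eventually_ball_finite, simp, rule ballI)
      fix j assume "j \<in> {..<32 * K\<^sup>2}"
      then have j: "cos (real r * (2 * pi * Lim q (\<lambda>n. \<Theta> n j))) > 0" using pos by simp
      have "((\<lambda>n. cos (real r * (2 * pi * \<Theta> n j))) \<longlongrightarrow> cos (real r * (2 * pi * Lim q (\<lambda>n. \<Theta> n j)))) q"
        by (intro tendsto_intros lim)
      from order_tendstoD(1)[OF this j] show "\<forall>\<^sub>F n in q. cos (real r * (2 * pi * \<Theta> n j)) > 0" .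
    qed
    moreover have "\<forall>\<^sub>F n in q. r < n"
      using q(2) eventually_gt_at_top filter_leD by blast
    ultimately have "\<forall>\<^sub>F n in q. r < n \<and> (\<forall>j\<in>{..<32 * K\<^sup>2}. cos (real r * (2 * pi * \<Theta> n j)) > 0)"
      by eventually_elim auto
    then obtain n where "r < n" "\<forall>j\<in>{..<32 * K\<^sup>2}. cos (real r * (2 * pi * \<Theta> n j)) > 0"
      using q(1) by (metis (no_types, lifting) eventually_happens ultrafilter_def)
    then show "\<exists>s1 s2 s3 s4. c s2 = c s1 \<and> c s3 = c s1 \<and> c s4 = c s1 \<and> s1 + s2 = r + s3 + s4"
      by (intro rep[of r n]) (auto intro: less_imp_le)
  qed
qed

section \<open>Positive functionals and the selection of sets\<close>

lemma bounded_range_real_iff: "bounded (range u) \<longleftrightarrow> (\<exists>M. \<forall>m. \<bar>u m :: real\<bar> \<le> M)"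
  by (simp add: bounded_iff)

lemma bounded_range_realI: "(\<And>m. \<bar>u m :: real\<bar> \<le> M) \<Longrightarrow> bounded (range u)"
  by (auto simp: bounded_range_real_iff)

lemma bounded_range_indicator: "bounded (range (indicator E :: nat \<Rightarrow> real))"
  by (rule bounded_range_realI[of _ 1]) (simp add: indicator_def)

lemma bounded_range_mult:
  assumes "bounded (range u)" "bounded (range v)"
  shows "bounded (range (\<lambda>m. u m * v m :: real))"
proof -
  obtain a b where "\<And>m. \<bar>u m\<bar> \<le> a" "\<And>m. \<bar>v m\<bar> \<le> b"
    using assms by (auto simp: bounded_range_real_iff)
  then have "\<bar>u m * v m\<bar> \<le> a * b" for m
    unfolding abs_mult by (intro mult_mono') auto
  then show ?thesis by (rule bounded_range_realI)
qed

lemma bounded_range_add: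
  "bounded (range u) \<Longrightarrow> bounded (range v) \<Longrightarrow> bounded (range (\<lambda>m. u m + v m :: real))"
  by (rule bounded_plus_comp)

lemma bounded_range_const: "bounded (range (\<lambda>m. c :: real))"
  by (rule bounded_range_realI[of _ "\<bar>c\<bar>"]) simp

lemma bounded_range_shift: "bounded (range u) \<Longrightarrow> bounded (range (\<lambda>m. u (m + k) :: real))"
  by (auto simp: bounded_range_real_iff)

lemmas bounded_range_intros =
  bounded_range_indicator bounded_range_mult bounded_range_add bounded_range_const

section \<open>Finitely additive masses from positive linear functionals\<close>

locale positive_functional =
  fixes \<Lambda> :: "(nat \<Rightarrow> real) \<Rightarrow> real"
  assumes add: "bounded (range u) \<Longrightarrow> bounded (range v) \<Longrightarrow> \<Lambda> (\<lambda>m. u m + v m) = \<Lambda> u + \<Lambda> v"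
    and scale: "bounded (range u) \<Longrightarrow> \<Lambda> (\<lambda>m. c * u m) = c * \<Lambda> u"
    and nonneg: "bounded (range u) \<Longrightarrow> (\<And>m. 0 \<le> u m) \<Longrightarrow> 0 \<le> \<Lambda> u"
begin

lemma mono:
  assumes "bounded (range u)" "bounded (range v)" "\<And>m. u m \<le> v m"
  shows "\<Lambda> u \<le> \<Lambda> v"
proof -
  have b: "bounded (range (\<lambda>m. (-1) * u m))" by (intro bounded_range_intros assms)
  have "0 \<le> \<Lambda> (\<lambda>m. v m + (-1) * u m)"
    by (rule nonneg[OF bounded_range_add[OF assms(2) b]]) (use assms in simp)
  also have "\<dots> = \<Lambda> v + (-1) * \<Lambda> u"
    by (subst add[OF assms(2) b]) (simp only: scale[OF assms(1)])
  finally show ?thesis by simp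
qed

lemma sum:
  assumes "finite S" "\<And>s. s \<in> S \<Longrightarrow> bounded (range (u s))"
  shows "\<Lambda> (\<lambda>m. \<Sum>s\<in>S. u s m) = (\<Sum>s\<in>S. \<Lambda> (u s)) \<and> bounded (range (\<lambda>m. \<Sum>s\<in>S. u s m))"
  using assms
proof (induction S rule: finite_induct)
  case empty
  show ?case using scale[of "\<lambda>_. 0" 0] by (simp add: bounded_range_const)
next
  case (insert s S)
  then have IH: "\<Lambda> (\<lambda>m. \<Sum>s\<in>S. u s m) = (\<Sum>s\<in>S. \<Lambda> (u s))" "bounded (range (\<lambda>m. \<Sum>s\<in>S. u s m))"
    and us: "bounded (range (u s))" by auto
  from add[OF us IH(2)] bounded_range_add[OF us IH(2)] IH(1) insert.hyps show ?case by simp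
qed

abbreviation mass :: "nat set \<Rightarrow> real" where "mass E \<equiv> \<Lambda> (indicator E)"

lemma mass_nonneg: "0 \<le> mass E"
  by (intro nonneg bounded_range_indicator) simp

lemma restrict_split:
  assumes "bounded (range u)" "E1 \<inter> E2 = {}"
  shows "\<Lambda> (\<lambda>m. indicator (E1 \<union> E2) m * u m) = \<Lambda> (\<lambda>m. indicator E1 m * u m) + \<Lambda> (\<lambda>m. indicator E2 m * u m)"
proof -
  have "(\<lambda>m. indicator (E1 \<union> E2) m * u m) = (\<lambda>m. indicator E1 m * u m + indicator E2 m * u m)"
    using assms(2) by (auto simp: fun_eq_iff indicator_def)
  then show ?thesis by (simp add: add bounded_range_intros assms(1))
qed

lemma mass_Un: "E1 \<inter> E2 = {} \<Longrightarrow> mass (E1 \<union> E2) = mass E1 + mass E2"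
  using restrict_split[of "\<lambda>_. 1" E1 E2] by (simp add: bounded_range_const)

lemma mass_pos_nonempty: "mass E > 0 \<Longrightarrow> E \<noteq> {}"
  using mass_Un[of "{}" "{}"] by auto

text \<open>In the applications the three indicators stand for the part to be kept, the exceptional
  set and a remainder term; the inequality then yields a lower bound for the mass of the
  first.\<close>

lemma le_restrict:
  assumes u: "bounded (range u)" and le: "\<And>m. u m \<le> c * indicator E m + c * indicator F m + d * indicator G m"
  shows "\<Lambda> u \<le> c * mass E + c * mass F + d * mass G"
proof -
  have "\<Lambda> u \<le> \<Lambda> (\<lambda>m. c * indicator E m + c * indicator F m + d * indicator G m)"
    by (intro mono u le bounded_range_intros)
  also have "\<dots> = c * mass E + c * mass F + d * mass G"
    by (subst add scale | intro bounded_range_intros)+ simp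
  finally show ?thesis .
qed

end

section \<open>Shrinking sets for a family of mean zero\<close>

text \<open>Intended reading: \<open>A N m\<close> averages \<open>fc\<close> against the shift of
  \<open>fanti\<close> by \<open>m\<close> over the \<open>N\<close>-th Foelner set, and
  \<open>B N\<close> collects the shifts to be avoided there. \<open>\<Lambda>\<close> acts on the
  variable \<open>m\<close>, while \<open>q\<close> governs \<open>N\<close>.\<close>

locale averaged_family = positive_functional +
  fixes q :: "nat filter" and A :: "nat \<Rightarrow> nat \<Rightarrow> real" and M :: real and B :: "nat \<Rightarrow> nat set"
  assumes q: "ultrafilter q" and A_bound: "\<bar>A N m\<bar> \<le> M" and A_zero: "\<Lambda> (A N) = 0"
    and bad: "\<kappa> > 0 \<Longrightarrow> \<forall>\<^sub>F N in q. \<Lambda> (indicator (B N)) < \<kappa>"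
    and total: "\<Lambda> (\<lambda>_. 1) > 0"
begin

text \<open>A finitely additive signed charge of total value 0, bounded above by
  \<open>M * mass\<close>. It records where the values of \<open>A N\<close> are positive on average
  for \<open>N\<close> along \<open>q\<close>.\<close>

definition I :: "nat set \<Rightarrow> real" where "I E = Lim q (\<lambda>N. \<Lambda> (\<lambda>m. indicator E m * A N m))"

lemma M_nonneg: "0 \<le> M" using A_bound[of 0 0] by linarith

lemma bounded_A: "bounded (range (A N))" using A_bound by (rule bounded_range_realI)

lemma bounded_EA: "bounded (range (\<lambda>m. indicator E m * A N m))"
  by (intro bounded_range_intros bounded_A)

lemma q_not_bot: "q \<noteq> bot" using q by (simp add: ultrafilter_def)

lemma tendsto_I: "((\<lambda>N. \<Lambda> (\<lambda>m. indicator E m * A N m)) \<longlongrightarrow> I E) q"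
  unfolding I_def
proof (rule ultrafilter_tendsto_bounded[OF q], rule bounded_range_realI)
  fix N
  have "\<Lambda> (\<lambda>m. indicator E m * A N m) \<le> \<Lambda> (\<lambda>m. M * 1)"
    using A_bound[of N] M_nonneg by (intro mono bounded_EA bounded_range_intros) (auto simp: indicator_def abs_le_iff)
  moreover have "\<Lambda> (\<lambda>m. (-M) * 1) \<le> \<Lambda> (\<lambda>m. indicator E m * A N m)"
    using A_bound[of N] M_nonneg
    by (intro mono bounded_EA bounded_range_intros) (auto simp: indicator_def abs_le_iff minus_le_iff)
  ultimately show "\<bar>\<Lambda> (\<lambda>m. indicator E m * A N m)\<bar> \<le> M * \<Lambda> (\<lambda>_. 1)"
    unfolding scale[OF bounded_range_const] by linarith
qed

lemma I_Un: "E1 \<inter> E2 = {} \<Longrightarrow> I (E1 \<union> E2) = I E1 + I E2"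
  using tendsto_I[of "E1 \<union> E2"] tendsto_add[OF tendsto_I[of E1] tendsto_I[of E2]]
  by (simp add: restrict_split bounded_A tendsto_unique[OF q_not_bot])

lemma I_le_mass: "I E \<le> M * mass E"
proof (rule tendsto_upperbound[OF tendsto_I _ q_not_bot], rule always_eventually, rule allI)
  fix N
  have "\<Lambda> (\<lambda>m. indicator E m * A N m) \<le> \<Lambda> (\<lambda>m. M * indicator E m)"
    using A_bound[of N] by (intro mono bounded_EA bounded_range_intros) (auto simp: indicator_def abs_le_iff)
  then show "\<Lambda> (\<lambda>m. indicator E m * A N m) \<le> M * mass E"
    by (simp add: scale bounded_range_indicator)
qed

text \<open>Sets that can be shrunk further: either there is a positive amount of slack in \<^term>\<open>I\<close>,
  or \<^term>\<open>I\<close> carries no information at all and only the mass matters.\<close>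

definition good :: "nat set \<Rightarrow> bool" where
  "good E \<longleftrightarrow> I E > 0 \<or> (\<forall>F\<subseteq>E. I F = 0) \<and> mass E > 0"

lemma good_mass:
  assumes "good E"
  shows "mass E > 0"
proof (rule ccontr)
  assume "\<not> mass E > 0"
  then have "mass E = 0" using mass_nonneg[of E] by simp
  then show False using I_le_mass[of E] assms by (simp add: good_def)
qed

text \<open>Both alternatives in \<open>good\<close> are partition regular: the first by additivity
  of \<open>I\<close>, the second by additivity of the mass, as vanishing of \<open>I\<close> on all
  subsets is inherited.\<close>

lemma good_split:
  assumes "good (E1 \<union> E2)" "E1 \<inter> E2 = {}"
  shows "good E1 \<or> good E2"
proof (cases "I (E1 \<union> E2) > 0")
  case True
  then show ?thesis using I_Un[OF assms(2)] by (auto simp: good_def)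
next
  case False
  then have z: "\<And>F. F \<subseteq> E1 \<union> E2 \<Longrightarrow> I F = 0" and "mass E1 + mass E2 > 0"
    using assms(1) mass_Un[OF assms(2)] by (auto simp: good_def)
  then consider "mass E1 > 0" | "mass E2 > 0" by linarith
  then show ?thesis by cases (use z in \<open>auto simp: good_def\<close>)
qed

text \<open>If \<open>I\<close> is nowhere positive, then \<open>I UNIV = 0\<close> and passing to
  complements force it to vanish everywhere, so that \<open>UNIV\<close> is good.\<close>

lemma good_exists: "\<exists>E. good E"
proof (cases "\<exists>E. I E > 0")
  case False
  have "I UNIV = 0"
    using tendsto_unique[OF q_not_bot tendsto_I[of UNIV], of 0] by (simp add: A_zero)
  then have "I E = 0" for E
  proof -
    have "I E \<le> 0" "I (- E) \<le> 0" using False by (auto simp: not_less)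
    with \<open>I UNIV = 0\<close> I_Un[of E "- E"] show ?thesis by (simp add: Compl_partition)
  qed
  then have "good UNIV" using total by (simp add: good_def indicator_def)
  then show ?thesis ..
qed (auto simp: good_def)

text \<open>A Fatou-type step for a merely finitely additive mass. If \<open>I E > 0\<close>, take a
  subset of nearly least mass among those keeping this value of \<open>I\<close>: for suitable
  \<open>N\<close> the points with \<open>A N m \<ge> 0\<close> outside \<open>B N\<close> are so
  massive that what remains must lose value, so they retain positive \<open>I\<close>. If
  \<open>I\<close> vanishes on all subsets, values below \<open>- \<epsilon>\<close> on almost all
  of \<open>E\<close> would contradict \<open>I E = 0\<close>.\<close>

lemma good_shrink:
  assumes E: "good E" and Q: "\<forall>\<^sub>F N in q. N \<in> Q" and \<epsilon>: "\<epsilon> > 0"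
  obtains N E' where "N \<in> Q" "E' \<subseteq> E" "good E'" "\<And>m. m \<in> E' \<Longrightarrow> A N m \<ge> - \<epsilon> \<and> m \<notin> B N"
proof (cases "I E > 0")
  case True
  define a where "a = I E"
  have a: "a > 0" using True by (simp add: a_def)
  have M: "M > 0" using I_le_mass[of E] a mass_nonneg[of E] M_nonneg
    by (auto simp: a_def less_le)
  \<comment> \<open>The infimum of \<open>X\<close> need not be attained, hence the margin
    \<open>a / (4 * M)\<close>, which the mass of \<open>F \<inter> V\<close> will exceed.\<close>
  define X where "X = mass ` {F. F \<subseteq> E \<and> I F \<ge> a}"
  have X: "X \<noteq> {}" "bdd_below X"
    using mass_nonneg by (auto simp: X_def a_def intro!: bdd_belowI[of _ 0])
  have "Inf X < Inf X + a / (4 * M)" using a M by simp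
  from cInf_lessD[OF X(1) this] obtain F where F: "F \<subseteq> E" "I F \<ge> a" "mass F < Inf X + a / (4 * M)"
    by (auto simp: X_def)
  have "\<forall>\<^sub>F N in q. \<Lambda> (\<lambda>m. indicator F m * A N m) > a / 2"
    using F a by (intro order_tendstoD(1)[OF tendsto_I]) linarith
  moreover have "\<forall>\<^sub>F N in q. mass (B N) < a / (4 * M)" using a M by (intro bad) simp
  ultimately have "\<forall>\<^sub>F N in q. N \<in> Q \<and> \<Lambda> (\<lambda>m. indicator F m * A N m) > a / 2 \<and> mass (B N) < a / (4 * M)"
    using Q by eventually_elim simp
  from eventually_happens'[OF q_not_bot this]
  obtain N where N: "N \<in> Q" "\<Lambda> (\<lambda>m. indicator F m * A N m) > a / 2" "mass (B N) < a / (4 * M)"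
    by blast
  define V where "V = {m. A N m \<ge> 0 \<and> m \<notin> B N}"
  have "\<Lambda> (\<lambda>m. indicator F m * A N m) \<le> M * mass (F \<inter> V) + M * mass (B N) + 0 * mass {}"
    using A_bound[of N] M
    by (intro le_restrict bounded_EA) (auto simp: indicator_def V_def abs_le_iff not_le intro: less_imp_le)
  with N have "M * mass (F \<inter> V) + M * mass (B N) > a / 2" by simp
  moreover have "M * mass (B N) < a / 4"
    using mult_strict_left_mono[OF N(3) M] M by simp
  ultimately have "M * mass (F \<inter> V) > a / 4" by simp
  then have "mass (F \<inter> V) > a / (4 * M)" using M by (simp add: field_simps)
  moreover have "mass F = mass (F \<inter> V) + mass (F - V)"
    using mass_Un[of "F \<inter> V" "F - V"] by (simp add: Int_Diff_disjoint Un_Diff_Int Un_commute)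
  ultimately have lt: "mass (F - V) < Inf X" using F(3) by linarith
  have "I (F - V) < a"
  proof (rule ccontr)
    assume "\<not> ?thesis"
    then have "mass (F - V) \<in> X" using F(1) by (auto simp: X_def)
    from cInf_lower[OF this X(2)] lt show False by simp
  qed
  moreover have "I F = I (F \<inter> V) + I (F - V)"
    using I_Un[of "F \<inter> V" "F - V"] by (simp add: Int_Diff_disjoint Un_Diff_Int Un_commute)
  ultimately have "good (F \<inter> V)" using F(2) by (simp add: good_def)
  moreover have "A N m \<ge> - \<epsilon> \<and> m \<notin> B N" if "m \<in> F \<inter> V" for m
    using that \<epsilon> by (auto simp: V_def)
  ultimately show ?thesis using that[of N "F \<inter> V"] N(1) F(1) by blast
next
  case False
  then have z: "\<And>F. F \<subseteq> E \<Longrightarrow> I F = 0" and mE: "mass E > 0" using E by (auto simp: good_def)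
  \<comment> \<open>As \<open>D - \<epsilon> = M\<close>, the term \<open>- \<epsilon>\<close> can
    be spread over all of \<open>E\<close>: on \<open>V\<close> and on \<open>B N\<close> the bound
    \<open>M\<close> is recovered, and elsewhere on \<open>E\<close> the value of \<open>A N\<close>
    is below \<open>- \<epsilon>\<close>.\<close>
  define D where "D = M + \<epsilon>"
  have D: "D > 0" using M_nonneg \<epsilon> by (simp add: D_def)
  have "\<forall>\<^sub>F N in q. \<Lambda> (\<lambda>m. indicator E m * A N m) > - (\<epsilon> * mass E / 2)"
    using z[of E] \<epsilon> mE by (intro order_tendstoD(1)[OF tendsto_I]) simp
  moreover have "\<forall>\<^sub>F N in q. mass (B N) < \<epsilon> * mass E / (4 * D)"
    using D \<epsilon> mE by (intro bad) simp
  ultimately have "\<forall>\<^sub>F N in q. N \<in> Q \<and> \<Lambda> (\<lambda>m. indicator E m * A N m) > - (\<epsilon> * mass E / 2)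
      \<and> mass (B N) < \<epsilon> * mass E / (4 * D)"
    using Q by eventually_elim simp
  from eventually_happens'[OF q_not_bot this]
  obtain N where N: "N \<in> Q" "\<Lambda> (\<lambda>m. indicator E m * A N m) > - (\<epsilon> * mass E / 2)"
    "mass (B N) < \<epsilon> * mass E / (4 * D)"
    by blast
  define V where "V = {m. A N m \<ge> - \<epsilon> \<and> m \<notin> B N}"
  have "\<Lambda> (\<lambda>m. indicator E m * A N m) \<le> D * mass (E \<inter> V) + D * mass (B N) + (- \<epsilon>) * mass E"
  proof (intro le_restrict bounded_EA)
    fix m
    show "indicator E m * A N m \<le> D * indicator (E \<inter> V) m + D * indicator (B N) m + (- \<epsilon>) * indicator E m"
      using A_bound[of N m] D \<epsilon> by (auto simp: D_def indicator_def V_def abs_le_iff)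
  qed
  moreover have "D * mass (B N) < \<epsilon> * mass E / 4"
    using mult_strict_left_mono[OF N(3) D] D by simp
  moreover have "\<epsilon> * mass E > 0" using \<epsilon> mE by simp
  ultimately have "D * mass (E \<inter> V) > 0" using N(2) by linarith
  then have "mass (E \<inter> V) > 0" using D by (simp add: zero_less_mult_iff)
  then have "good (E \<inter> V)" using z by (auto simp: good_def)
  moreover have "A N m \<ge> - \<epsilon> \<and> m \<notin> B N" if "m \<in> E \<inter> V" for m
    using that by (simp add: V_def)
  ultimately show ?thesis using that[of N "E \<inter> V"] N(1) by blast
qed

text \<open>Induction on the number \<open>k\<close> of intervals of length
  \<open>\<epsilon>\<close> that cover the values of \<open>u\<close> on the set: split off the
  lowest interval and keep a good piece by \<open>good_split\<close>.\<close>

lemma good_small_oscillation: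
  assumes E: "good E" and u: "\<And>m. \<bar>u m\<bar> \<le> (c::real)" and \<epsilon>: "\<epsilon> > 0"
  obtains E' where "E' \<subseteq> E" "good E'" "\<And>m m'. m \<in> E' \<Longrightarrow> m' \<in> E' \<Longrightarrow> \<bar>u m - u m'\<bar> \<le> \<epsilon>"
proof -
  have main: "\<exists>E'\<subseteq>E. good E' \<and> (\<forall>m\<in>E'. \<forall>m'\<in>E'. \<bar>u m - u m'\<bar> \<le> \<epsilon>)"
    if "good E" "\<forall>m\<in>E. l \<le> u m \<and> u m \<le> l + real k * \<epsilon>" for k l E
    using that
  proof (induction k arbitrary: l E)
    case 0
    then have "u m = l" if "m \<in> E" for m using that by force
    with 0 \<epsilon> show ?case by (intro exI[of _ E]) simp
  next
    case (Suc k)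
    let ?E1 = "E \<inter> {m. u m \<le> l + \<epsilon>}" and ?E2 = "E \<inter> {m. u m > l + \<epsilon>}"
    have "?E1 \<union> ?E2 = E" "?E1 \<inter> ?E2 = {}" by auto
    then consider "good ?E1" | "good ?E2" using good_split[of ?E1 ?E2] Suc.prems(1) by auto
    then show ?case
    proof cases
      case 1
      have "\<forall>m\<in>?E1. \<forall>m'\<in>?E1. \<bar>u m - u m'\<bar> \<le> \<epsilon>"
      proof (intro ballI)
        fix m m' assume "m \<in> ?E1" "m' \<in> ?E1"
        then have "l \<le> u m" "u m \<le> l + \<epsilon>" "l \<le> u m'" "u m' \<le> l + \<epsilon>" using Suc.prems(2) by auto
        then show "\<bar>u m - u m'\<bar> \<le> \<epsilon>" by linarith
      qed
      with 1 show ?thesis by blast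
    next
      case 2
      have "\<forall>m\<in>?E2. l + \<epsilon> \<le> u m \<and> u m \<le> (l + \<epsilon>) + real k * \<epsilon>"
        using Suc.prems(2) by (auto simp: algebra_simps)
      from Suc.IH[OF 2 this] show ?thesis by blast
    qed
  qed
  obtain k where k: "2 * c < real k * \<epsilon>" using \<epsilon> ex_less_of_nat_mult by blast
  have "\<forall>m\<in>E. - c \<le> u m \<and> u m \<le> - c + real k * \<epsilon>"
  proof
    fix m
    show "- c \<le> u m \<and> u m \<le> - c + real k * \<epsilon>" using u[of m] k by linarith
  qed
  from main[OF E this] show ?thesis using that by blast
qed

text \<open>Dependent choice of triples: a good set \<open>E\<close>, its index \<open>N\<close>,
  and a set \<open>Q\<close> of indices still admissible, large along \<open>q\<close>. Each new
  \<open>Q\<close> lies in \<open>Qf E\<close>, in \<open>{N<..}\<close> and in the old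
  \<open>Q\<close>, so later indices meet the demands of all earlier sets; an index need not meet
  the demand of its own set.\<close>

lemma selection:
  assumes Qf: "\<And>E. mass E > 0 \<Longrightarrow> \<forall>\<^sub>F N in q. N \<in> Qf E" and seq: "q \<le> sequentially"
  obtains E :: "nat \<Rightarrow> nat set" and N :: "nat \<Rightarrow> nat" where
    "decseq E" "strict_mono N" "\<And>i. mass (E i) > 0" "\<And>i k. i < k \<Longrightarrow> N k \<in> Qf (E i)"
    "\<And>i m. m \<in> E i \<Longrightarrow> A (N i) m \<ge> - inverse (real (Suc i)) \<and> m \<notin> B (N i)"
    "\<And>i m m'. m \<in> E i \<Longrightarrow> m' \<in> E i \<Longrightarrow> \<bar>A (N i) m - A (N i) m'\<bar> \<le> inverse (real (Suc i))"
proof -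
  define P where "P i = (\<lambda>(E, N, Q). good E \<and> (\<forall>\<^sub>F N in q. N \<in> Q) \<and> Q \<subseteq> Qf E \<inter> {N<..} \<and>
     (\<forall>m\<in>E. A N m \<ge> - inverse (real (Suc i)) \<and> m \<notin> B N) \<and>
     (\<forall>m\<in>E. \<forall>m'\<in>E. \<bar>A N m - A N m'\<bar> \<le> inverse (real (Suc i))))" for i :: nat
  define R where "R = (\<lambda>(E :: nat set, N :: nat, Q :: nat set) (E', N', Q'). E' \<subseteq> E \<and> N' \<in> Q \<and> Q' \<subseteq> Q)"
  have step: "\<exists>E' N' Q'. P i (E', N', Q') \<and> E' \<subseteq> E \<and> N' \<in> Q \<and> Q' \<subseteq> Q"
    if gE: "good E" and gQ: "\<forall>\<^sub>F N in q. N \<in> Q" for E Q i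
  proof -
    have pos: "inverse (real (Suc i)) > 0" by simp
    obtain N' E1 where 1: "N' \<in> Q" "E1 \<subseteq> E" "good E1" "\<And>m. m \<in> E1 \<Longrightarrow> A N' m \<ge> - inverse (real (Suc i)) \<and> m \<notin> B N'"
      by (rule good_shrink[OF gE gQ pos]) (rule that)
    obtain E2 where 2: "E2 \<subseteq> E1" "good E2"
      "\<And>m m'. m \<in> E2 \<Longrightarrow> m' \<in> E2 \<Longrightarrow> \<bar>A N' m - A N' m'\<bar> \<le> inverse (real (Suc i))"
      by (rule good_small_oscillation[OF 1(3) A_bound pos]) (rule that)
    have "\<forall>\<^sub>F N in q. N \<in> Qf E2" by (rule Qf[OF good_mass[OF 2(2)]])
    moreover have "\<forall>\<^sub>F N in q. N' < N" using seq eventually_gt_at_top filter_leD by blast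
    ultimately have "\<forall>\<^sub>F N in q. N \<in> Q \<inter> Qf E2 \<inter> {N'<..}"
      using gQ by eventually_elim auto
    with 1 2 show ?thesis
      by (intro exI[of _ E2] exI[of _ N'] exI[of _ "Q \<inter> Qf E2 \<inter> {N'<..}"]) (auto simp: P_def)
  qed
  have "\<exists>f. \<forall>i. P i (f i) \<and> R (f i) (f (Suc i))"
  proof (rule dependent_nat_choice)
    obtain E where "good E" using good_exists by blast
    with step[of E UNIV 0] show "\<exists>x. P 0 x" by auto
    fix x i assume x: "P i x"
    obtain E N Q where "x = (E, N, Q)" by (cases x)
    with x step[of E Q "Suc i"] show "\<exists>y. P (Suc i) y \<and> R x y" by (auto simp: P_def R_def)
  qed
  then obtain f where f: "\<And>i. P i (f i)" "\<And>i. R (f i) (f (Suc i))" by blast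
  define E N Q where "E i = fst (f i)" and "N i = fst (snd (f i))" and "Q i = snd (snd (f i))" for i
  have P: "P i (E i, N i, Q i)" and R: "R (E i, N i, Q i) (E (Suc i), N (Suc i), Q (Suc i))" for i
    using f by (simp_all add: E_def N_def Q_def)
  have E: "decseq E" using R by (auto simp: R_def intro: decseq_SucI)
  have Q: "decseq Q" using R by (auto simp: R_def intro: decseq_SucI)
  have NQ: "N k \<in> Q i" if "i < k" for i k
  proof -
    from that obtain k' where k: "k = Suc k'" "i \<le> k'" by (cases k) auto
    then have "N k \<in> Q k'" using R by (auto simp: R_def)
    with decseqD[OF Q k(2)] show ?thesis by blast
  qed
  show ?thesis
  proof (rule that[OF E])
    show "strict_mono N"
      using NQ P by (intro strict_monoI_Suc) (fastforce simp: P_def)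
    show "mass (E i) > 0" for i using P[of i] good_mass by (simp add: P_def)
    show "N k \<in> Qf (E i)" if "i < k" for i k
      using NQ[OF that] P[of i] by (auto simp: P_def)
    show "A (N i) m \<ge> - inverse (real (Suc i)) \<and> m \<notin> B (N i)" if "m \<in> E i" for i m
      using P[of i] that unfolding P_def by blast
    show "\<bar>A (N i) m - A (N i) m'\<bar> \<le> inverse (real (Suc i))" if "m \<in> E i" "m' \<in> E i" for i m m'
      using P[of i] that unfolding P_def by blast
  qed
qed

end

section \<open>Averages along Foelner sequences and trigonometric polynomials\<close>

lemma folner_finite: "folner \<Phi> \<Longrightarrow> finite (\<Phi> N)"
  by (simp add: folner_def)

lemma folner_card_pos: "folner \<Phi> \<Longrightarrow> card (\<Phi> N) > 0"
  by (simp add: folner_def card_gt_0_iff)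

lemma avg_add: "avg \<Phi> (\<lambda>n. u n + v n) N = avg \<Phi> u N + avg \<Phi> v N"
  by (simp add: avg_def sum.distrib add_divide_distrib)

lemma avg_scale: "avg \<Phi> (\<lambda>n. c * u n) N = c * avg \<Phi> u N"
  by (simp add: avg_def sum_distrib_left)

lemma avg_const: "folner \<Phi> \<Longrightarrow> avg \<Phi> (\<lambda>n. c) N = c"
  using folner_card_pos[of \<Phi> N] by (simp add: avg_def)

lemma avg_mono: "(\<And>n. u n \<le> v n) \<Longrightarrow> avg \<Phi> u N \<le> (avg \<Phi> v N :: real)"
  by (simp add: avg_def divide_right_mono sum_mono)

lemma avg_nonneg: "(\<And>n. 0 \<le> u n) \<Longrightarrow> 0 \<le> (avg \<Phi> u N :: real)"
  by (simp add: avg_def sum_nonneg)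

lemma norm_avg_le:
  assumes "folner \<Phi>" "\<And>n. norm (u n) \<le> c"
  shows "norm (avg \<Phi> u N) \<le> c"
proof -
  have "norm (\<Sum>n\<in>\<Phi> N. u n) \<le> card (\<Phi> N) * c"
    using sum_norm_bound[of "\<Phi> N" u c] assms(2) by simp
  then show ?thesis
    using folner_card_pos[OF assms(1), of N] by (simp add: avg_def norm_divide field_simps)
qed

lemma bounded_avg:
  assumes "folner \<Phi>" "bounded (range u)"
  shows "bounded (range (avg \<Phi> u :: nat \<Rightarrow> real))"
proof -
  obtain M where "\<And>m. \<bar>u m\<bar> \<le> M" using assms(2) by (auto simp: bounded_range_real_iff)
  then show ?thesis using norm_avg_le[OF assms(1), of u M] by (intro bounded_range_realI[of _ M]) simp
qed

lemma avg_of_real: "avg \<Phi> (\<lambda>n. complex_of_real (u n)) N = complex_of_real (avg \<Phi> u N)"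
  by (simp add: avg_def)

text \<open>The sums over the translated and the original set cancel except on the symmetric
  difference, whose relative size tends to 0.\<close>

lemma folner_avg_shift:
  fixes u :: "nat \<Rightarrow> 'a::real_normed_field"
  assumes F: "folner \<Phi>" and u: "\<And>n. norm (u n) \<le> M"
  shows "(\<lambda>N. avg \<Phi> (\<lambda>n. u (n + m)) N - avg \<Phi> u N) \<longlonglongrightarrow> 0"
proof (rule Lim_null_comparison)
  let ?r = "\<lambda>N. real (card (((\<lambda>n. n + m) ` \<Phi> N) \<union> \<Phi> N - ((\<lambda>n. n + m) ` \<Phi> N) \<inter> \<Phi> N)) / real (card (\<Phi> N))"
  show "\<forall>\<^sub>F N in sequentially. norm (avg \<Phi> (\<lambda>n. u (n + m)) N - avg \<Phi> u N) \<le> M * ?r N"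
  proof (rule always_eventually, rule allI)
    fix N
    let ?A = "(\<lambda>n. n + m) ` \<Phi> N" and ?B = "\<Phi> N"
    have fin: "finite ?A" "finite ?B" using folner_finite[OF F] by auto
    have "(\<Sum>n\<in>?B. u (n + m)) = sum u ?A" by (subst sum.reindex) (auto simp: inj_on_def)
    also have "sum u ?A = sum u (?A - ?B) + sum u (?A \<inter> ?B)"
      using fin by (metis add.commute sum.Int_Diff)
    finally have "(\<Sum>n\<in>?B. u (n + m)) - sum u ?B = sum u (?A - ?B) - sum u (?B - ?A)"
      using fin sum.Int_Diff[of ?B u ?A] by (simp add: Int_commute)
    then have "norm ((\<Sum>n\<in>?B. u (n + m)) - sum u ?B) \<le> norm (sum u (?A - ?B)) + norm (sum u (?B - ?A))"
      by (simp add: norm_triangle_ineq4)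
    also have "\<dots> \<le> card (?A - ?B) * M + card (?B - ?A) * M"
      using u by (intro add_mono) (auto intro!: sum_norm_bound)
    also have "\<dots> = M * card ((?A - ?B) \<union> (?B - ?A))"
      using fin by (subst card_Un_disjoint) (auto simp: algebra_simps)
    also have "(?A - ?B) \<union> (?B - ?A) = ?A \<union> ?B - ?A \<inter> ?B" by auto
    finally show "norm (avg \<Phi> (\<lambda>n. u (n + m)) N - avg \<Phi> u N) \<le> M * ?r N"
      by (simp add: avg_def norm_divide divide_right_mono flip: diff_divide_distrib)
  qed
  have "?r \<longlonglongrightarrow> 0" using F by (simp add: folner_def)
  from tendsto_mult_right_zero[OF this] show "(\<lambda>N. M * ?r N) \<longlonglongrightarrow> 0" .
qed

section \<open>Trigonometric polynomials as the span of characters\<close>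

text \<open>Arbitrary real frequencies and closure rules, so that products, conjugates and limits of
  averages are handled by induction instead of by coefficient lists.\<close>

inductive texp :: "(nat \<Rightarrow> complex) \<Rightarrow> bool" where
  cis: "texp (\<lambda>n. cis (a * real n))"
| scale: "texp u \<Longrightarrow> texp (\<lambda>n. c * u n)"
| add: "texp u \<Longrightarrow> texp v \<Longrightarrow> texp (\<lambda>n. u n + v n)"

lemma texp_const: "texp (\<lambda>n. c)"
  using texp.scale[OF texp.cis[of 0], of c] by simp

lemma texp_sum: "(\<And>j. j \<in> S \<Longrightarrow> texp (u j)) \<Longrightarrow> texp (\<lambda>n. \<Sum>j\<in>S. u j n)"
  by (induction S rule: infinite_finite_induct) (auto intro: texp_const texp.add)

lemma texp_diff: "texp u \<Longrightarrow> texp v \<Longrightarrow> texp (\<lambda>n. u n - v n)"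
  using texp.add[OF _ texp.scale, of u v "-1"] by simp

lemma texp_mult_cis: "texp u \<Longrightarrow> texp (\<lambda>n. cis (a * real n) * u n)"
proof (induction rule: texp.induct)
  case (cis b)
  then show ?case using texp.cis[of "a + b"] by (simp add: cis_mult algebra_simps)
next
  case (scale u c)
  from texp.scale[OF this(2), of c] show ?case by (simp add: mult.left_commute)
next
  case (add u v)
  from texp.add[OF add(3,4)] show ?case by (simp add: distrib_left)
qed

lemma texp_mult: "texp u \<Longrightarrow> texp v \<Longrightarrow> texp (\<lambda>n. u n * v n)"
proof (induction rule: texp.induct)
  case (cis a)
  then show ?case by (rule texp_mult_cis)
next
  case (scale u c)
  from texp.scale[OF scale(2)[OF scale(3)], of c] show ?case by (simp add: mult.assoc)
next
  case (add u u')
  from texp.add[OF add(3)[OF add(5)] add(4)[OF add(5)]] show ?case by (simp add: distrib_right)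
qed

lemma texp_cnj: "texp u \<Longrightarrow> texp (\<lambda>n. cnj (u n))"
proof (induction rule: texp.induct)
  case (cis a)
  then show ?case using texp.cis[of "- a"] by (simp add: cis_cnj)
qed (auto intro: texp.scale texp.add)

lemma texp_cos: "texp (\<lambda>n. complex_of_real (cos (a * real n)))"
proof -
  have eq: "complex_of_real (cos (a * real n)) = (1/2) * (cis (a * real n) + cis ((-a) * real n))" for n
    by (simp add: complex_eq_iff)
  show ?thesis unfolding eq by (intro texp.intros)
qed

lemma texp_bounded: "texp u \<Longrightarrow> \<exists>M. \<forall>n. cmod (u n) \<le> M"
proof (induction rule: texp.induct)
  case (cis a)
  show ?case by (intro exI[of _ 1]) simp
next
  case (scale u c)
  then obtain M where "\<forall>n. cmod (u n) \<le> M" by blast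
  then show ?case by (intro exI[of _ "cmod c * M"]) (simp add: norm_mult mult_left_mono)
next
  case (add u v)
  then obtain M M' where "\<forall>n. cmod (u n) \<le> M" "\<forall>n. cmod (v n) \<le> M'" by blast
  then show ?case by (intro exI[of _ "M + M'"]) (meson add_mono norm_triangle_ineq order_trans)
qed

lemma texp_trig_poly: "trig_poly P \<Longrightarrow> texp P"
proof -
  assume "trig_poly P"
  then obtain J c \<theta> where P: "P = (\<lambda>n. \<Sum>j<(J::nat). c j * exp (2 * pi * \<i> * complex_of_real (\<theta> j) * of_nat n))"
    unfolding trig_poly_def by blast
  have "exp (2 * pi * \<i> * complex_of_real (\<theta> j) * of_nat n) = cis (2 * pi * \<theta> j * real n)" for j n
    by (simp add: cis_conv_exp mult_ac)
  then show ?thesis unfolding P by (simp only:) (intro texp_sum texp.intros)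
qed

text \<open>The Foelner property by itself controls each fixed shift; uniformity in \<open>m\<close>
  comes from the characters. Shifting a character by \<open>m\<close> multiplies its average by
  \<open>cis (a * m)\<close>, and this average tends to 0 unless the character is constant, in which
  case the difference is 0.\<close>

lemma texp_avg_shift_uniform:
  assumes F: "folner \<Phi>"
  shows "texp u \<Longrightarrow> \<epsilon> > 0 \<Longrightarrow> \<forall>\<^sub>F N in sequentially. \<forall>m. cmod (avg \<Phi> (\<lambda>n. u (n + m)) N - avg \<Phi> u N) \<le> \<epsilon>"
proof (induction arbitrary: \<epsilon> rule: texp.induct)
  case (cis a)
  have eq: "avg \<Phi> (\<lambda>n. cis (a * real (n + m))) N - avg \<Phi> (\<lambda>n. cis (a * real n)) N
      = (cis (a * real m) - 1) * avg \<Phi> (\<lambda>n. cis (a * real n)) N" for m N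
  proof -
    have "avg \<Phi> (\<lambda>n. cis (a * real (n + m))) N = avg \<Phi> (\<lambda>n. cis (a * real m) * cis (a * real n)) N"
      by (simp add: cis_mult algebra_simps)
    then show ?thesis by (simp only: avg_scale left_diff_distrib mult_1)
  qed
  show ?case
  proof (cases "cis a = 1")
    case True
    then have "cis (a * real m) = 1" for m
      by (metis Complex.DeMoivre mult.commute power_one)
    with cis show ?thesis unfolding eq by simp
  next
    case False
    \<comment> \<open>The shift by one suffices: it multiplies the average by \<open>cis a\<close>,
      and the nonzero factor \<open>cis a - 1\<close> can be divided out.\<close>
    have "(\<lambda>N. avg \<Phi> (\<lambda>n. cis (a * real (n + 1))) N - avg \<Phi> (\<lambda>n. cis (a * real n)) N) \<longlonglongrightarrow> 0"
      by (rule folner_avg_shift[OF F, of _ 1]) simp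
    then have "(\<lambda>N. (cis a - 1) * avg \<Phi> (\<lambda>n. cis (a * real n)) N) \<longlonglongrightarrow> 0"
      unfolding eq by simp
    then have "(\<lambda>N. inverse (cis a - 1) * ((cis a - 1) * avg \<Phi> (\<lambda>n. cis (a * real n)) N)) \<longlonglongrightarrow> 0"
      by (rule tendsto_mult_right_zero)
    moreover have "inverse (cis a - 1) * ((cis a - 1) * z) = z" for z using False by simp
    ultimately have "avg \<Phi> (\<lambda>n. cis (a * real n)) \<longlonglongrightarrow> 0" by simp
    from tendstoD[OF this, of "\<epsilon> / 2"] cis
    have "\<forall>\<^sub>F N in sequentially. cmod (avg \<Phi> (\<lambda>n. cis (a * real n)) N) < \<epsilon> / 2"
      by (simp add: dist_norm)
    then show ?thesis
    proof eventually_elim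
      case (elim N)
      have "cmod (cis (a * real m) - 1) \<le> 2" for m
        using norm_triangle_ineq4[of "cis (a * real m)" 1] by simp
      then have "cmod (cis (a * real m) - 1) * cmod (avg \<Phi> (\<lambda>n. cis (a * real n)) N) \<le> 2 * (\<epsilon> / 2)" for m
        using elim by (intro mult_mono) auto
      then show ?case unfolding eq by (simp add: norm_mult)
    qed
  qed
next
  case (scale u c)
  define d where "d = \<epsilon> / (cmod c + 1)"
  have c: "cmod c + 1 > 0" by (simp add: add_nonneg_pos)
  then have "d > 0" using scale.prems by (simp add: d_def)
  from scale.IH[OF this] show ?case
  proof eventually_elim
    case (elim N)
    have "cmod c * cmod (avg \<Phi> (\<lambda>n. u (n + m)) N - avg \<Phi> u N) \<le> (cmod c + 1) * d" for m
      using elim by (intro mult_mono) auto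
    moreover have "(cmod c + 1) * d = \<epsilon>" using c by (simp add: d_def)
    ultimately show ?case by (simp add: avg_scale norm_mult flip: right_diff_distrib)
  qed
next
  case (add u v)
  have "\<epsilon> / 2 > 0" using add.prems by simp
  from add.IH(1)[OF this] add.IH(2)[OF this] show ?case
  proof eventually_elim
    case (elim N)
    show ?case
    proof
      fix m
      have "avg \<Phi> (\<lambda>n. u (n + m) + v (n + m)) N - avg \<Phi> (\<lambda>n. u n + v n) N
        = (avg \<Phi> (\<lambda>n. u (n + m)) N - avg \<Phi> u N) + (avg \<Phi> (\<lambda>n. v (n + m)) N - avg \<Phi> v N)"
        by (simp add: avg_add)
      then show "cmod (avg \<Phi> (\<lambda>n. u (n + m) + v (n + m)) N - avg \<Phi> (\<lambda>n. u n + v n) N) \<le> \<epsilon>"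
        using elim norm_triangle_le[of "avg \<Phi> (\<lambda>n. u (n + m)) N - avg \<Phi> u N" "avg \<Phi> (\<lambda>n. v (n + m)) N - avg \<Phi> v N" \<epsilon>]
        by (metis add_mono field_sum_of_halves)
    qed
  qed
qed

text \<open>\<open>Bes_perp\<close> speaks of frequencies in [0,1); the fractional part of
  \<open>a / (2 * pi)\<close> gives the same character on the integers.\<close>

lemma Bes_perp_cis:
  assumes "(\<lambda>n. complex_of_real (h n)) \<in> Bes_perp \<Phi>"
  shows "avg \<Phi> (\<lambda>n. cis (a * real n) * complex_of_real (h n)) \<longlonglongrightarrow> 0"
proof -
  define \<theta> where "\<theta> = frac (a / (2 * pi))"
  have "cis (a * real n) = exp (2 * pi * \<i> * of_nat n * complex_of_real \<theta>)" for n
  proof -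
    have "a = 2 * pi * \<theta> + 2 * pi * of_int \<lfloor>a / (2 * pi)\<rfloor>"
      by (simp add: \<theta>_def frac_def algebra_simps)
    then have "cis (a * real n) = cis (2 * pi * \<theta> * real n + 2 * pi * of_int (\<lfloor>a / (2 * pi)\<rfloor> * int n))"
      by (metis (no_types, lifting) distrib_right mult.assoc of_int_mult of_int_of_nat_eq)
    also have "\<dots> = cis (2 * pi * \<theta> * real n)"
      by (subst cis_mult[symmetric], subst cis_multiple_2pi) auto
    finally show ?thesis by (simp add: cis_conv_exp mult_ac)
  qed
  moreover have "0 \<le> \<theta> \<and> \<theta> < 1" by (simp add: \<theta>_def frac_lt_1)
  ultimately show ?thesis using assms by (simp add: Bes_perp_def mult.commute)
qed

text \<open>For a character, the limit for the unshifted product carries over to the product shifted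
  by \<open>k\<close>, and multiplying by \<open>cis (- a * k)\<close> removes the shift from the
  character.\<close>

lemma texp_Bes_perp:
  assumes F: "folner \<Phi>" and h: "(\<lambda>n. complex_of_real (h n)) \<in> Bes_perp \<Phi>" "\<And>n. \<bar>h n\<bar> \<le> H"
  shows "texp u \<Longrightarrow> avg \<Phi> (\<lambda>m. u m * complex_of_real (h (m + k))) \<longlonglongrightarrow> 0"
proof (induction rule: texp.induct)
  case (cis a)
  have "(\<lambda>N. avg \<Phi> (\<lambda>n. cis (a * real (n + k)) * complex_of_real (h (n + k))) N
      - avg \<Phi> (\<lambda>n. cis (a * real n) * complex_of_real (h n)) N) \<longlonglongrightarrow> 0"
    by (rule folner_avg_shift[OF F, of "\<lambda>n. cis (a * real n) * complex_of_real (h n)" H])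
       (simp add: norm_mult h)
  from tendsto_add[OF this Bes_perp_cis[OF h(1), of a]]
  have "avg \<Phi> (\<lambda>n. cis (a * real (n + k)) * complex_of_real (h (n + k))) \<longlonglongrightarrow> 0" by simp
  then have "(\<lambda>N. cis (- a * real k) * avg \<Phi> (\<lambda>n. cis (a * real (n + k)) * complex_of_real (h (n + k))) N) \<longlonglongrightarrow> 0"
    by (rule tendsto_mult_right_zero)
  then show ?case
    by (simp add: cis_mult algebra_simps flip: avg_scale mult.assoc)
next
  case (scale u c)
  from tendsto_mult_right_zero[OF this(2), of c] show ?case
    by (simp add: mult.assoc flip: avg_scale)
next
  case (add u v)
  from tendsto_add[OF add(3,4)] show ?case by (simp add: distrib_right flip: avg_add)
qed

section \<open>Means and compact functions\<close>

lemma positive_functional_weighted: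
  assumes "positive_functional \<Lambda>" and w: "bounded (range w)" "\<And>m. 0 \<le> w m"
  shows "positive_functional (\<lambda>u. \<Lambda> (\<lambda>m. w m * u m))"
proof -
  interpret positive_functional \<Lambda> by fact
  show ?thesis
  proof
    fix u v :: "nat \<Rightarrow> real" and c
    assume u: "bounded (range u)"
    have wu: "bounded (range (\<lambda>m. w m * u m))" by (intro bounded_range_mult w u)
    show "\<Lambda> (\<lambda>m. w m * (c * u m)) = c * \<Lambda> (\<lambda>m. w m * u m)"
      using scale[OF wu, of c] by (simp add: mult.left_commute)
    show "0 \<le> \<Lambda> (\<lambda>m. w m * u m)" if "\<And>m. 0 \<le> u m"
      using wu by (rule nonneg) (use w that in auto)
    assume v: "bounded (range v)"
    show "\<Lambda> (\<lambda>m. w m * (u m + v m)) = \<Lambda> (\<lambda>m. w m * u m) + \<Lambda> (\<lambda>m. w m * v m)"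
      using add[OF wu bounded_range_mult[OF w(1) v]] by (simp add: distrib_left)
  qed
qed

section \<open>A shift-invariant mean from an ultrafilter\<close>

locale folner_mean =
  fixes \<Phi> :: "nat \<Rightarrow> nat set" and q :: "nat filter"
  assumes F: "folner \<Phi>" and uq: "ultrafilter q" and seq: "q \<le> sequentially"
begin

definition L :: "(nat \<Rightarrow> real) \<Rightarrow> real" where "L u = Lim q (avg \<Phi> u)"

lemma q_nontrivial: "q \<noteq> bot" using uq by (simp add: ultrafilter_def)

lemma tendsto_L: "bounded (range u) \<Longrightarrow> (avg \<Phi> u \<longlongrightarrow> L u) q"
  unfolding L_def by (intro ultrafilter_tendsto_bounded uq bounded_avg F)

lemma L_eqI: "(avg \<Phi> u \<longlongrightarrow> l) q \<Longrightarrow> L u = l"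
  unfolding L_def by (rule tendsto_Lim[OF q_nontrivial])

lemma L_eq_of_LIMSEQ: "avg \<Phi> u \<longlonglongrightarrow> l \<Longrightarrow> L u = l"
  by (rule L_eqI) (rule tendsto_mono[OF seq])

sublocale positive_functional L
proof
  fix u v :: "nat \<Rightarrow> real" and c
  assume u: "bounded (range u)"
  show "L (\<lambda>m. c * u m) = c * L u"
    using tendsto_mult_left[OF tendsto_L[OF u], of c] by (intro L_eqI) (simp add: avg_scale[abs_def])
  show "0 \<le> L u" if "\<And>m. 0 \<le> u m"
    by (rule tendsto_lowerbound[OF tendsto_L[OF u] _ q_nontrivial]) (simp add: avg_nonneg that)
  assume v: "bounded (range v)"
  show "L (\<lambda>m. u m + v m) = L u + L v"
    using tendsto_add[OF tendsto_L[OF u] tendsto_L[OF v]] by (intro L_eqI) (simp add: avg_add[abs_def])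
qed

lemma L_le:
  assumes "bounded (range u)" "\<forall>\<^sub>F N in sequentially. avg \<Phi> u N \<le> c"
  shows "L u \<le> c"
  by (rule tendsto_upperbound[OF tendsto_L[OF assms(1)] filter_leD[OF seq assms(2)] q_nontrivial])

lemma L_const: "L (\<lambda>_. c) = c"
  by (rule L_eqI) (simp add: avg_const[OF F, abs_def])

lemma L_shift:
  assumes u: "bounded (range u)"
  shows "L (\<lambda>m. u (m + k)) = L u"
proof -
  obtain M where M: "\<And>m. \<bar>u m\<bar> \<le> M" using u by (auto simp: bounded_range_real_iff)
  have "(\<lambda>N. avg \<Phi> (\<lambda>n. u (n + k)) N - avg \<Phi> u N) \<longlonglongrightarrow> 0"
    by (rule folner_avg_shift[OF F]) (use M in simp)
  then have "((\<lambda>N. avg \<Phi> (\<lambda>n. u (n + k)) N - avg \<Phi> u N) \<longlongrightarrow> 0) q"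
    by (rule tendsto_mono[OF seq])
  moreover have "((\<lambda>N. avg \<Phi> (\<lambda>n. u (n + k)) N - avg \<Phi> u N) \<longlongrightarrow> L (\<lambda>m. u (m + k)) - L u) q"
    by (intro tendsto_diff tendsto_L u bounded_range_shift)
  ultimately have "L (\<lambda>m. u (m + k)) - L u = 0" using tendsto_unique[OF q_nontrivial] by blast
  then show ?thesis by simp
qed

text \<open>Here \<open>n\<close> runs over the points of a Foelner set and \<open>m\<close> over
  shifts; the average over \<open>n\<close> is a finite sum, so linearity gives the
  interchange.\<close>

lemma L_avg:
  assumes "\<And>n. bounded (range (u n))"
  shows "L (\<lambda>m. avg \<Phi> (\<lambda>n. u n m) N) = avg \<Phi> (\<lambda>n. L (u n)) N"
    and "bounded (range (\<lambda>m. avg \<Phi> (\<lambda>n. u n m) N))"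
proof -
  have eq: "(\<lambda>m. avg \<Phi> (\<lambda>n. u n m) N) = (\<lambda>m. inverse (card (\<Phi> N)) * (\<Sum>n\<in>\<Phi> N. u n m))"
    by (simp add: avg_def divide_inverse mult.commute)
  note s = sum[OF folner_finite[OF F, of N] assms]
  show "L (\<lambda>m. avg \<Phi> (\<lambda>n. u n m) N) = avg \<Phi> (\<lambda>n. L (u n)) N"
    unfolding eq using s by (simp add: scale avg_def divide_inverse mult.commute)
  show "bounded (range (\<lambda>m. avg \<Phi> (\<lambda>n. u n m) N))"
    unfolding eq using s by (intro bounded_range_mult bounded_range_const) simp
qed

end

section \<open>The seminorm in terms of eventual bounds on averages\<close>

lemma sqnorm_nonneg: "0 \<le> sqnorm \<Phi> u"
proof -
  have "(0::ereal) = limsup (\<lambda>N. 0)" by (simp add: Limsup_const)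
  also have "\<dots> \<le> sqnorm \<Phi> u" unfolding sqnorm_def
    by (intro Limsup_mono always_eventually) (simp add: avg_nonneg)
  finally show ?thesis .
qed

text \<open>The slack \<open>c < \<delta>\<^sup>2\<close> encodes strictness of the limsup; the
  real-valued right-hand side passes directly to subsequences.\<close>

lemma phinorm_less_iff:
  assumes "\<delta> > 0"
  shows "phinorm \<Phi> u < ereal \<delta> \<longleftrightarrow> (\<exists>c<\<delta>\<^sup>2. \<forall>\<^sub>F N in sequentially. avg \<Phi> (\<lambda>n. (cmod (u n))\<^sup>2) N \<le> c)"
proof
  assume less: "phinorm \<Phi> u < ereal \<delta>"
  then have "sqnorm \<Phi> u \<noteq> \<infinity>" by (auto simp: phinorm_def)
  then obtain x where x: "sqnorm \<Phi> u = ereal x" "x \<ge> 0"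
    using sqnorm_nonneg[of \<Phi> u] by (cases "sqnorm \<Phi> u") auto
  with less have "sqrt x < \<delta>" by (simp add: phinorm_def)
  then have "x < \<delta>\<^sup>2" using real_sqrt_less_iff[of x "\<delta>\<^sup>2"] assms by simp
  then obtain c where c: "x < c" "c < \<delta>\<^sup>2" using dense by blast
  have "limsup (\<lambda>N. ereal (avg \<Phi> (\<lambda>n. (cmod (u n))\<^sup>2) N)) < ereal c"
    using x(1) c(1) by (simp add: sqnorm_def)
  then have "\<forall>\<^sub>F N in sequentially. ereal (avg \<Phi> (\<lambda>n. (cmod (u n))\<^sup>2) N) < ereal c"
    by (rule Limsup_lessD)
  then have "\<forall>\<^sub>F N in sequentially. avg \<Phi> (\<lambda>n. (cmod (u n))\<^sup>2) N \<le> c"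
    by eventually_elim simp
  with c(2) show "\<exists>c<\<delta>\<^sup>2. \<forall>\<^sub>F N in sequentially. avg \<Phi> (\<lambda>n. (cmod (u n))\<^sup>2) N \<le> c" by blast
next
  assume "\<exists>c<\<delta>\<^sup>2. \<forall>\<^sub>F N in sequentially. avg \<Phi> (\<lambda>n. (cmod (u n))\<^sup>2) N \<le> c"
  then obtain c where c: "c < \<delta>\<^sup>2" "\<forall>\<^sub>F N in sequentially. avg \<Phi> (\<lambda>n. (cmod (u n))\<^sup>2) N \<le> c" by blast
  have "sqnorm \<Phi> u \<le> ereal c"
    unfolding sqnorm_def by (rule Limsup_bounded) (use c(2) in simp)
  then obtain x where x: "sqnorm \<Phi> u = ereal x" "x \<le> c"
    using sqnorm_nonneg[of \<Phi> u] by (cases "sqnorm \<Phi> u") auto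
  have "x < \<delta>\<^sup>2" using x(2) c(1) by simp
  then have "sqrt x < \<delta>" using real_sqrt_less_iff[of x "\<delta>\<^sup>2"] assms by simp
  then show "phinorm \<Phi> u < ereal \<delta>" using x(1) by (simp add: phinorm_def)
qed

text \<open>The gap between \<open>c\<close> and \<open>c'\<close> absorbs the Foelner error of the
  shift, in either direction.\<close>

lemma eventually_avg_shift:
  fixes u :: "nat \<Rightarrow> real"
  assumes F: "folner \<Phi>" and u: "bounded (range u)" and c: "c < c'"
  shows "(\<forall>\<^sub>F N in sequentially. avg \<Phi> u N \<le> c) \<Longrightarrow> \<forall>\<^sub>F N in sequentially. avg \<Phi> (\<lambda>n. u (n + k)) N \<le> c'"
    and "(\<forall>\<^sub>F N in sequentially. avg \<Phi> (\<lambda>n. u (n + k)) N \<le> c) \<Longrightarrow> \<forall>\<^sub>F N in sequentially. avg \<Phi> u N \<le> c'"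
proof -
  obtain M where M: "\<And>m. \<bar>u m\<bar> \<le> M" using u by (auto simp: bounded_range_real_iff)
  have "(\<lambda>N. avg \<Phi> (\<lambda>n. u (n + k)) N - avg \<Phi> u N) \<longlonglongrightarrow> 0"
    by (rule folner_avg_shift[OF F]) (use M in simp)
  from tendstoD[OF this, of "c' - c"] c
  have d: "\<forall>\<^sub>F N in sequentially. \<bar>avg \<Phi> (\<lambda>n. u (n + k)) N - avg \<Phi> u N\<bar> < c' - c"
    by (simp add: dist_norm)
  show "\<forall>\<^sub>F N in sequentially. avg \<Phi> (\<lambda>n. u (n + k)) N \<le> c'" if "\<forall>\<^sub>F N in sequentially. avg \<Phi> u N \<le> c"
    using that d by eventually_elim linarith
  show "\<forall>\<^sub>F N in sequentially. avg \<Phi> u N \<le> c'" if "\<forall>\<^sub>F N in sequentially. avg \<Phi> (\<lambda>n. u (n + k)) N \<le> c"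
    using that d by eventually_elim linarith
qed

lemma eventually_avg_square_add:
  fixes u v :: "nat \<Rightarrow> real"
  assumes "\<forall>\<^sub>F N in sequentially. avg \<Phi> (\<lambda>n. (u n)\<^sup>2) N \<le> a" "\<forall>\<^sub>F N in sequentially. avg \<Phi> (\<lambda>n. (v n)\<^sup>2) N \<le> b"
  shows "\<forall>\<^sub>F N in sequentially. avg \<Phi> (\<lambda>n. (u n + v n)\<^sup>2) N \<le> 2 * (a + b)"
  using assms
proof eventually_elim
  case (elim N)
  have "avg \<Phi> (\<lambda>n. (u n + v n)\<^sup>2) N \<le> avg \<Phi> (\<lambda>n. 2 * ((u n)\<^sup>2 + (v n)\<^sup>2)) N"
  proof (rule avg_mono)
    fix n
    show "(u n + v n)\<^sup>2 \<le> 2 * ((u n)\<^sup>2 + (v n)\<^sup>2)"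
      using sum_squares_bound[of "u n" "v n"] by (simp add: power2_sum)
  qed
  then show ?case using elim by (simp add: avg_scale avg_add)
qed

text \<open>Colour \<open>m\<close> by an element of a finite
  net close to \<open>R\<^sup>m f\<close>; equality of colours makes \<open>R\<^sup>s f\<close> and \<open>R\<^sup>t f\<close> close, and shifts are almost isometric.\<close>

lemma compact_returns_Bohr:
  assumes F: "folner \<Phi>" and f: "bounded (range f)" and comp: "compact_along \<Phi> (\<lambda>n. complex_of_real (f n))"
    and \<epsilon>: "\<epsilon> > 0"
  shows "\<exists>(J::nat) \<theta>. \<forall>r. (\<forall>j<J. cos (real r * (2 * pi * \<theta> j)) > 0) \<longrightarrow>
       phinorm \<Phi> (\<lambda>n. complex_of_real (f (n + r) - f n)) < ereal \<epsilon>"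
proof -
  \<comment> \<open>Error budget in units of \<open>\<delta>\<^sup>2\<close>: 1 from the net, 4 for
    two shifts of one colour, 5 after a further shift, 20 after adding two such terms, 21 after
    shifting back; and 21/64 < 1.\<close>
  define \<delta> where "\<delta> = \<epsilon> / 8"
  have \<delta>: "\<delta> > 0" using \<epsilon> by (simp add: \<delta>_def)
  obtain K where "\<forall>m. \<exists>k\<in>{1..K}. phinorm \<Phi> (\<lambda>n. complex_of_real (f (n + m)) - complex_of_real (f (n + k))) < ereal \<delta>"
    using comp \<delta> unfolding compact_along_def shift_def by blast
  then obtain c where c: "\<And>m. c m \<in> {1..K}"
      "\<And>m. phinorm \<Phi> (\<lambda>n. complex_of_real (f (n + m)) - complex_of_real (f (n + c m))) < ereal \<delta>"
    by metis
  have near: "\<forall>\<^sub>F N in sequentially. avg \<Phi> (\<lambda>n. (f (n + m) - f (n + c m))\<^sup>2) N \<le> \<delta>\<^sup>2" for m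
  proof -
    obtain d where "d < \<delta>\<^sup>2"
      "\<forall>\<^sub>F N in sequentially. avg \<Phi> (\<lambda>n. (cmod (complex_of_real (f (n + m)) - complex_of_real (f (n + c m))))\<^sup>2) N \<le> d"
      using c(2)[of m] unfolding phinorm_less_iff[OF \<delta>] by blast
    then show ?thesis by (simp flip: of_real_diff) (auto elim: eventually_mono)
  qed
  have sq: "\<forall>\<^sub>F N in sequentially. avg \<Phi> (\<lambda>n. (f (n + s) - f (n + t))\<^sup>2) N \<le> 4 * \<delta>\<^sup>2" if "c s = c t" for s t
  proof -
    have "\<forall>\<^sub>F N in sequentially. avg \<Phi> (\<lambda>n. (f (n + c t) - f (n + t))\<^sup>2) N \<le> \<delta>\<^sup>2"
      using near[of t] by (simp add: power2_commute)
    from eventually_avg_square_add[OF near[of s] this] show ?thesis using that by simp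
  qed
  have bsq: "bounded (range (\<lambda>n. (f (n + s) - f (n + t))\<^sup>2))" for s t
  proof -
    obtain M where M: "\<And>m. \<bar>f m\<bar> \<le> M" using f by (auto simp: bounded_range_real_iff)
    have "\<bar>f (n + s) - f (n + t)\<bar> \<le> 2 * M" for n using M[of "n + s"] M[of "n + t"] by linarith
    then have "bounded (range (\<lambda>n. f (n + s) - f (n + t)))" by (rule bounded_range_realI)
    then show ?thesis unfolding power2_eq_square by (intro bounded_range_mult)
  qed
  have cK: "c m < Suc K" for m using c(1)[of m] by simp
  obtain J :: nat and \<theta> where rep: "\<forall>r. (\<forall>j<J. cos (real r * (2 * pi * \<theta> j)) > 0) \<longrightarrow>
       (\<exists>s1 s2 s3 s4. c s2 = c s1 \<and> c s3 = c s1 \<and> c s4 = c s1 \<and> s1 + s2 = r + s3 + s4)"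
    using bogolyubov_colouring[of c, OF cK] by blast
  show ?thesis
  proof (intro exI[of _ J] exI[of _ \<theta>] allI impI)
    fix r assume "\<forall>j<J. cos (real r * (2 * pi * \<theta> j)) > 0"
    with rep obtain s1 s2 s3 s4 where
      s: "c s1 = c s3" "c s2 = c s4" "s1 + s2 = r + s3 + s4" by metis
    have lt: "4 * \<delta>\<^sup>2 < 5 * \<delta>\<^sup>2" "2 * (5 * \<delta>\<^sup>2 + 5 * \<delta>\<^sup>2) < 21 * \<delta>\<^sup>2" using \<delta> by simp_all
    have "\<forall>\<^sub>F N in sequentially. avg \<Phi> (\<lambda>n. (f (n + s2 + s1) - f (n + s2 + s3))\<^sup>2) N \<le> 5 * \<delta>\<^sup>2"
      by (rule eventually_avg_shift(1)[OF F bsq lt(1) sq[OF s(1)], of s2])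
    moreover have "\<forall>\<^sub>F N in sequentially. avg \<Phi> (\<lambda>n. (f (n + s3 + s2) - f (n + s3 + s4))\<^sup>2) N \<le> 5 * \<delta>\<^sup>2"
      by (rule eventually_avg_shift(1)[OF F bsq lt(1) sq[OF s(2)], of s3])
    ultimately have "\<forall>\<^sub>F N in sequentially. avg \<Phi> (\<lambda>n. ((f (n + s2 + s1) - f (n + s2 + s3)) +
        (f (n + s3 + s2) - f (n + s3 + s4)))\<^sup>2) N \<le> 2 * (5 * \<delta>\<^sup>2 + 5 * \<delta>\<^sup>2)"
      by (rule eventually_avg_square_add)
    \<comment> \<open>The relation \<open>s1 + s2 = r + s3 + s4\<close> makes the sum telescope: the
      middle terms cancel and the arguments of the outer ones differ by \<open>r\<close>.\<close>
    moreover have "(f (n + s2 + s1) - f (n + s2 + s3)) + (f (n + s3 + s2) - f (n + s3 + s4))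
        = f (n + (s3 + s4) + r) - f (n + (s3 + s4) + 0)" for n
    proof -
      have e: "n + s2 + s1 = n + (s3 + s4) + r" "n + s2 + s3 = n + s3 + s2" "n + s3 + s4 = n + (s3 + s4) + 0"
        using s(3) by linarith+
      show ?thesis unfolding e by linarith
    qed
    ultimately have "\<forall>\<^sub>F N in sequentially. avg \<Phi> (\<lambda>n. (f (n + (s3 + s4) + r) - f (n + (s3 + s4) + 0))\<^sup>2) N
        \<le> 2 * (5 * \<delta>\<^sup>2 + 5 * \<delta>\<^sup>2)" by simp
    from eventually_avg_shift(2)[OF F bsq lt(2) this]
    have "\<forall>\<^sub>F N in sequentially. avg \<Phi> (\<lambda>n. (cmod (complex_of_real (f (n + r) - f n)))\<^sup>2) N \<le> 21 * \<delta>\<^sup>2"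
      by (simp flip: of_real_diff)
    moreover have "21 * \<delta>\<^sup>2 < \<epsilon>\<^sup>2" using \<epsilon> by (simp add: \<delta>_def power_divide)
    ultimately show "phinorm \<Phi> (\<lambda>n. complex_of_real (f (n + r) - f n)) < ereal \<epsilon>"
      unfolding phinorm_less_iff[OF \<epsilon>] by blast
  qed
qed

section \<open>Bohr weights and exceptional sets\<close>

lemma texp_real_polynomial:
  assumes "real_polynomial_function (g :: real \<Rightarrow> real)" and t: "texp (\<lambda>n. complex_of_real (t n))"
  shows "texp (\<lambda>n. complex_of_real (g (t n)))"
  using assms(1)
proof (induction rule: real_polynomial_function.induct)
  case (linear g)
  then obtain c where "g = (\<lambda>x. x * c)" by (auto simp: real_bounded_linear)
  with texp.scale[OF t, of "complex_of_real c"] show ?case by (simp add: mult.commute)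
next
  case (const c)
  show ?case by (rule texp_const)
next
  case (add f g)
  from texp.add[OF add(3,4)] show ?case by simp
next
  case (mult f g)
  from texp_mult[OF mult(3,4)] show ?case by simp
qed

text \<open>Positive exactly where the sum of cosines is within \<open>\<eta>\<close> of its upper
  bound \<open>J\<close>. Unlike the indicator of a Bohr set, it is a continuous function of a
  trigonometric polynomial.\<close>

definition bohr_weight :: "nat \<Rightarrow> (nat \<Rightarrow> real) \<Rightarrow> real \<Rightarrow> nat \<Rightarrow> real" where
  "bohr_weight J a \<eta> n = max 0 ((\<Sum>j<J. cos (a j * real n)) - (real J - \<eta>))"

lemma bohr_weight_nonneg: "0 \<le> bohr_weight J a \<eta> n"
  by (simp add: bohr_weight_def)

lemma bohr_weight_le: "\<eta> > 0 \<Longrightarrow> bohr_weight J a \<eta> n \<le> \<eta>"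
  using sum_bounded_above[of "{..<J}" "\<lambda>j. cos (a j * real n)" 1]
  by (auto simp: bohr_weight_def)

lemma bounded_bohr_weight: "\<eta> > 0 \<Longrightarrow> bounded (range (bohr_weight J a \<eta>))"
  by (rule bounded_range_realI[of _ \<eta>]) (simp add: bohr_weight_nonneg bohr_weight_le)

text \<open>The other cosines are at most 1, so a single one cannot fall short by
  \<open>\<eta>\<close>.\<close>

lemma bohr_weight_posD:
  assumes "bohr_weight J a \<eta> n > 0" "j < J"
  shows "cos (a j * real n) > 1 - \<eta>"
proof -
  have "(\<Sum>i<J. cos (a i * real n)) = cos (a j * real n) + (\<Sum>i\<in>{..<J} - {j}. cos (a i * real n))"
    using assms(2) by (intro sum.remove) auto
  moreover have "(\<Sum>i\<in>{..<J} - {j}. cos (a i * real n)) \<le> real (card ({..<J} - {j})) * 1"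
    by (rule sum_bounded_above) simp
  moreover have "real (card ({..<J} - {j})) = real J - 1" using assms(2) by (simp add: of_nat_diff)
  ultimately show ?thesis using assms(1) by (simp add: bohr_weight_def split: if_splits)
qed

text \<open>By Weierstrass the truncation is uniformly close to a polynomial on an interval
  containing all the cosine sums, and a polynomial in a trigonometric polynomial is again
  one.\<close>

lemma bohr_weight_uniform_approx:
  assumes "\<epsilon> > 0"
  obtains P where "texp (\<lambda>n. complex_of_real (P n))" "\<And>n. \<bar>bohr_weight J a \<eta> n - P n\<bar> < \<epsilon>"
proof -
  define t where "t n = (\<Sum>j<J. cos (a j * real n))" for n
  have t: "texp (\<lambda>n. complex_of_real (t n))"
    unfolding t_def of_real_sum by (intro texp_sum texp_cos)
  have t_in: "t n \<in> {- real J..real J}" for n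
  proof -
    have "\<bar>t n\<bar> \<le> (\<Sum>j<J. \<bar>cos (a j * real n)\<bar>)" unfolding t_def by (rule sum_abs)
    also have "\<dots> \<le> real J" using sum_bounded_above[of "{..<J}" "\<lambda>j. \<bar>cos (a j * real n)\<bar>" 1] by simp
    finally show ?thesis by (simp add: abs_le_iff)
  qed
  have "continuous_on {- real J..real J} (\<lambda>x. max 0 (x - (real J - \<eta>)))"
    by (intro continuous_intros)
  from Stone_Weierstrass_real_polynomial_function[OF compact_Icc this assms]
  obtain g where g: "real_polynomial_function g"
    "\<And>x. x \<in> {- real J..real J} \<Longrightarrow> \<bar>max 0 (x - (real J - \<eta>)) - g x\<bar> < \<epsilon>" by blast
  show thesis
    by (rule that[OF texp_real_polynomial[OF g(1) t]])
       (use g(2)[OF t_in] in \<open>simp add: bohr_weight_def t_def\<close>)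
qed

section \<open>Trigonometric approximation, orthogonality to Bohr weights and exceptional
  shifts\<close>

lemma cmod_sum4_sq: "(cmod (a + b + c + d))\<^sup>2 \<le> 4 * ((cmod a)\<^sup>2 + (cmod b)\<^sup>2 + (cmod c)\<^sup>2 + (cmod d)\<^sup>2)"
proof -
  have two: "(cmod (x + y))\<^sup>2 \<le> 2 * ((cmod x)\<^sup>2 + (cmod y)\<^sup>2)" for x y
  proof -
    have "(cmod (x + y))\<^sup>2 \<le> (cmod x + cmod y)\<^sup>2" by (intro power_mono norm_triangle_ineq) simp
    also have "\<dots> \<le> 2 * ((cmod x)\<^sup>2 + (cmod y)\<^sup>2)"
      using sum_squares_bound[of "cmod x" "cmod y"] by (simp add: power2_sum)
    finally show ?thesis .
  qed
  show ?thesis using two[of "a + b" "c + d"] two[of a b] two[of c d] by (simp add: add.assoc)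
qed

lemma Bes_approx:
  assumes f: "(\<lambda>n. complex_of_real (f n)) \<in> Bes \<Phi>" and \<gamma>: "\<gamma> > 0"
  obtains P where "trig_poly P"
    "\<forall>\<^sub>F N in sequentially. avg \<Phi> (\<lambda>n. (cmod (complex_of_real (f n) - P n))\<^sup>2) N \<le> \<gamma>"
proof -
  have s: "sqrt \<gamma> > 0" using \<gamma> by simp
  then obtain P where P: "trig_poly P" "phinorm \<Phi> (\<lambda>n. complex_of_real (f n) - P n) < ereal (sqrt \<gamma>)"
    using f unfolding Bes_def by blast
  then obtain c where "c < (sqrt \<gamma>)\<^sup>2" "\<forall>\<^sub>F N in sequentially. avg \<Phi> (\<lambda>n. (cmod (complex_of_real (f n) - P n))\<^sup>2) N \<le> c"
    unfolding phinorm_less_iff[OF s] by blast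
  then have "\<forall>\<^sub>F N in sequentially. avg \<Phi> (\<lambda>n. (cmod (complex_of_real (f n) - P n))\<^sup>2) N \<le> \<gamma>"
    using \<gamma> by (auto elim: eventually_mono)
  with P(1) show ?thesis by (rule that)
qed

context folner_mean
begin

text \<open>Replacing the weight by a uniformly close trigonometric polynomial costs at most
  \<open>e / 2\<close>, and the averages of that polynomial against a shift of \<open>h\<close> tend
  to 0.\<close>

lemma L_bohr_weight_perp:
  assumes h: "(\<lambda>n. complex_of_real (h n)) \<in> Bes_perp \<Phi>" "bounded (range h)"
  shows "L (\<lambda>m. bohr_weight J a \<eta> m * h (m + k)) = 0"
proof (rule L_eq_of_LIMSEQ, rule tendstoI)
  fix e :: real assume e: "e > 0"
  obtain H0 where "\<And>m. \<bar>h m\<bar> \<le> H0" using h(2) by (auto simp: bounded_range_real_iff)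
  then have H: "\<bar>h m\<bar> \<le> max H0 1" for m by (meson max.coboundedI1)
  define H where "H = max H0 1"
  have H0: "H > 0" by (simp add: H_def)
  have "e / (2 * H) > 0" using e H0 by simp
  then obtain P where P: "texp (\<lambda>n. complex_of_real (P n))" "\<And>n. \<bar>bohr_weight J a \<eta> n - P n\<bar> < e / (2 * H)"
    using bohr_weight_uniform_approx by metis
  have "avg \<Phi> (\<lambda>m. complex_of_real (P m) * complex_of_real (h (m + k))) \<longlonglongrightarrow> 0"
    by (rule texp_Bes_perp[OF F h(1) _ P(1)]) (rule H)
  then have "avg \<Phi> (\<lambda>m. complex_of_real (P m * h (m + k))) \<longlonglongrightarrow> 0" by simp
  then have "(\<lambda>N. complex_of_real (avg \<Phi> (\<lambda>m. P m * h (m + k)) N)) \<longlonglongrightarrow> of_real 0"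
    by (simp only: avg_of_real[abs_def] of_real_0)
  then have "(\<lambda>N. avg \<Phi> (\<lambda>m. P m * h (m + k)) N) \<longlonglongrightarrow> 0"
    by (simp only: tendsto_of_real_iff)
  from tendstoD[OF this, of "e / 2"] e
  have "\<forall>\<^sub>F N in sequentially. \<bar>avg \<Phi> (\<lambda>m. P m * h (m + k)) N\<bar> < e / 2" by (simp add: dist_norm)
  then show "\<forall>\<^sub>F N in sequentially. dist (avg \<Phi> (\<lambda>m. bohr_weight J a \<eta> m * h (m + k)) N) 0 < e"
  proof eventually_elim
    case (elim N)
    have bd: "norm ((bohr_weight J a \<eta> m - P m) * h (m + k)) \<le> e / (2 * H) * H" for m
      unfolding real_norm_def abs_mult using P(2)[of m] H[of "m + k"] H0
      by (intro mult_mono) (auto simp: H_def less_imp_le)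
    have "norm (avg \<Phi> (\<lambda>m. (bohr_weight J a \<eta> m - P m) * h (m + k)) N) \<le> e / (2 * H) * H"
      by (rule norm_avg_le[OF F bd])
    then have "\<bar>avg \<Phi> (\<lambda>m. (bohr_weight J a \<eta> m - P m) * h (m + k)) N\<bar> \<le> e / 2" using H0 by simp
    moreover have "avg \<Phi> (\<lambda>m. bohr_weight J a \<eta> m * h (m + k)) N
        = avg \<Phi> (\<lambda>m. (bohr_weight J a \<eta> m - P m) * h (m + k)) N + avg \<Phi> (\<lambda>m. P m * h (m + k)) N"
      by (simp add: left_diff_distrib flip: avg_add)
    ultimately show ?case using elim by simp
  qed
qed

text \<open>Pigeonhole on the torus: some cell of a fine grid is visited with positive mass, and differences of
  visits to the same cell lie in the Bohr set.\<close>

lemma L_bohr_weight_pos: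
  assumes \<eta>: "\<eta> > 0"
  shows "L (bohr_weight J a \<eta>) > 0"
proof -
  \<comment> \<open>\<open>J\<close> cosines each short of 1 by at most \<open>\<gamma>\<close> lose
    at most \<open>\<eta> / 2\<close> together; the summand 1 covers \<open>J = 0\<close>.\<close>
  define \<gamma> where "\<gamma> = \<eta> / (2 * (real J + 1))"
  have \<gamma>: "\<gamma> > 0" using \<eta> by (simp add: \<gamma>_def)
  have "isCont (\<lambda>x::real. cos (2 * pi * x)) 0" by (intro continuous_intros)
  then obtain d where d: "d > 0" "\<And>x. \<bar>x\<bar> < d \<Longrightarrow> \<bar>cos (2 * pi * x) - 1\<bar> < \<gamma>"
    using \<gamma> unfolding continuous_at_eps_delta by (force simp: dist_real_def)
  obtain R where R: "inverse (real (Suc R)) < d" using reals_Archimedean[OF d(1)] by blast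
  define x where "x j m = frac (a j * real m / (2 * pi))" for j m
  \<comment> \<open>The cell containing the phases of \<open>m\<close> modulo 1, in the
    \<open>J\<close>-dimensional grid with \<open>Suc R\<close> intervals per coordinate.\<close>
  define box where "box m = map (\<lambda>j. nat \<lfloor>real (Suc R) * x j m\<rfloor>) [0..<J]" for m
  have x01: "0 \<le> x j m" "x j m < 1" for j m by (auto simp: x_def frac_lt_1)
  let ?C = "{xs. set xs \<subseteq> {..<Suc R} \<and> length xs = J}"
  have fin: "finite ?C" by (rule finite_lists_length_eq) simp
  have boxC: "box m \<in> ?C" for m
  proof -
    have "nat \<lfloor>real (Suc R) * x j m\<rfloor> < Suc R" for j
    proof -
      have "real (Suc R) * x j m < real (Suc R) * 1" using x01 by (intro mult_strict_left_mono) auto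
      then have "\<lfloor>real (Suc R) * x j m\<rfloor> < int (Suc R)" by (simp add: floor_less_iff)
      then show ?thesis by simp
    qed
    then show ?thesis by (auto simp: box_def)
  qed
  have "(\<Sum>c\<in>?C. L (indicator {m. box m = c})) = L (\<lambda>m. \<Sum>c\<in>?C. indicator {m. box m = c} m)"
    using sum[OF fin, of "\<lambda>c. indicator {m. box m = c}"] by (simp add: bounded_range_indicator)
  also have "(\<lambda>m. \<Sum>c\<in>?C. indicator {m. box m = c} m) = (\<lambda>m. 1 :: real)"
  proof
    fix m
    have "(\<Sum>c\<in>?C. indicator {m. box m = c} m) = (\<Sum>c\<in>?C. if box m = c then 1 else (0::real))"
      by (intro sum.cong) (auto simp: indicator_def)
    also have "\<dots> = 1" using fin boxC[of m] by simp
    finally show "(\<Sum>c\<in>?C. indicator {m. box m = c} m) = (1::real)" .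
  qed
  finally have "(\<Sum>c\<in>?C. L (indicator {m. box m = c})) = 1" by (simp add: L_const)
  then obtain c where c: "L (indicator {m. box m = c}) > 0"
    by (metis (no_types, lifting) not_less sum_nonpos zero_less_one)
  have "\<exists>k. box k = c"
  proof (rule ccontr)
    assume "\<nexists>k. box k = c"
    then have "indicator {m. box m = c} = (\<lambda>m. 0 :: real)" by (auto simp: indicator_def)
    with c show False by (simp add: L_const)
  qed
  then obtain k where k: "box k = c" ..
  \<comment> \<open>A fixed visit \<open>k\<close> anchors the differences: if \<open>m + k\<close>
    lies in the same cell, all phases of \<open>m\<close> are close to integers. Shift invariance
    then transfers the mass of the cell to the weight.\<close>
  have key: "(\<eta> / 2) * indicator {m. box m = c} (m + k) \<le> bohr_weight J a \<eta> m" for m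
  proof (cases "box (m + k) = c")
    case True
    have "cos (a j * real m) > 1 - \<gamma>" if j: "j < J" for j
    proof -
      have "box (m + k) ! j = box k ! j" using True k by simp
      then have "nat \<lfloor>real (Suc R) * x j (m + k)\<rfloor> = nat \<lfloor>real (Suc R) * x j k\<rfloor>"
        using j by (simp add: box_def)
      moreover have "0 \<le> \<lfloor>real (Suc R) * x j (m + k)\<rfloor>" "0 \<le> \<lfloor>real (Suc R) * x j k\<rfloor>"
        using x01 by simp_all
      ultimately have "\<lfloor>real (Suc R) * x j (m + k)\<rfloor> = \<lfloor>real (Suc R) * x j k\<rfloor>" by (simp only: nat_eq_iff2 int_nat_eq if_True)
      then have "\<bar>real (Suc R) * x j (m + k) - real (Suc R) * x j k\<bar> < 1" by linarith
      then have "real (Suc R) * \<bar>x j (m + k) - x j k\<bar> < 1"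
        by (simp only: right_diff_distrib[symmetric] abs_mult abs_of_nat)
      then have "\<bar>x j (m + k) - x j k\<bar> < inverse (real (Suc R))"
        by (simp add: field_simps)
      then have "\<bar>cos (2 * pi * (x j (m + k) - x j k)) - 1\<bar> < \<gamma>" using R by (intro d(2)) simp
      moreover have "cos (2 * pi * (x j (m + k) - x j k)) = cos (a j * real m)"
      proof -
        define z :: int where "z = \<lfloor>a j * real k / (2 * pi)\<rfloor> - \<lfloor>a j * real (m + k) / (2 * pi)\<rfloor>"
        have eq: "2 * pi * (x j (m + k) - x j k) = a j * real m + 2 * pi * of_int z"
          by (simp add: x_def frac_def z_def field_simps)
        show ?thesis unfolding eq cos_add sin_int_2pin cos_int_2pin by simp
      qed
      ultimately show ?thesis by linarith
    qed
    then have "(\<Sum>j<J. cos (a j * real m)) \<ge> real J * (1 - \<gamma>)"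
      using sum_bounded_below[of "{..<J}" "1 - \<gamma>" "\<lambda>j. cos (a j * real m)"] by (simp add: less_imp_le)
    moreover have "real J * \<gamma> \<le> \<eta> / 2" using \<eta> by (simp add: \<gamma>_def field_simps)
    ultimately have "(\<Sum>j<J. cos (a j * real m)) - (real J - \<eta>) \<ge> \<eta> / 2" by (simp add: algebra_simps)
    then have "bohr_weight J a \<eta> m \<ge> \<eta> / 2" unfolding bohr_weight_def by (rule max.coboundedI2)
    with True show ?thesis by simp
  qed (simp add: bohr_weight_nonneg)
  have "0 < (\<eta> / 2) * L (indicator {m. box m = c})" using c \<eta> by simp
  also have "\<dots> = (\<eta> / 2) * L (\<lambda>m. indicator {m. box m = c} (m + k))"
    by (simp add: L_shift bounded_range_indicator)
  also have "\<dots> = L (\<lambda>m. (\<eta> / 2) * indicator {m. box m = c} (m + k))"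
    by (rule scale[symmetric]) (intro bounded_range_shift bounded_range_indicator)
  also have "\<dots> \<le> L (bohr_weight J a \<eta>)"
    by (intro mono key bounded_bohr_weight \<eta> bounded_range_mult bounded_range_const bounded_range_shift bounded_range_indicator)
  finally show ?thesis .
qed

text \<open>The polynomial \<open>A\<close> is fixed, but comparing it with better and better approximations \<open>P\<close> shows that the
  exceptional set becomes negligible: \<open>|P - A|\<^sup>2\<close> is itself a trigonometric polynomial, so its averages are
  shift-invariant uniformly in the shift.\<close>

lemma exceptional_mass:
  assumes f: "(\<lambda>n. complex_of_real (f n)) \<in> Bes \<Phi>" "bounded (range f)" and s: "s > 0"
    and A: "texp A" "\<forall>\<^sub>F N in sequentially. avg \<Phi> (\<lambda>n. (cmod (complex_of_real (f n) - A n))\<^sup>2) N \<le> s"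
    and W: "\<And>m n. m \<in> W \<Longrightarrow> (cmod (A (n + m) - A n))\<^sup>2 \<le> s" and \<kappa>: "\<kappa> > 0"
  shows "\<forall>\<^sub>F N in sequentially. L (indicator {m\<in>W. avg \<Phi> (\<lambda>n. (f (n + m) - f n)\<^sup>2) N > 32 * s}) < \<kappa>"
proof -
  \<comment> \<open>\<open>\<gamma> \<le> s\<close> lets all errors be counted in units of
    \<open>s\<close>, and \<open>\<gamma> < \<kappa> * s\<close> makes the final Markov bound
    \<open>\<gamma> / s\<close> smaller than \<open>\<kappa>\<close>.\<close>
  define \<gamma> where "\<gamma> = min s (\<kappa> * s / 2)"
  have \<gamma>: "\<gamma> > 0" "\<gamma> \<le> s" "\<gamma> < \<kappa> * s" using s \<kappa> by (auto simp: \<gamma>_def min_less_iff_disj)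
  obtain P where P: "trig_poly P"
    "\<forall>\<^sub>F N in sequentially. avg \<Phi> (\<lambda>n. (cmod (complex_of_real (f n) - P n))\<^sup>2) N \<le> \<gamma>"
    by (rule Bes_approx[OF f(1) \<gamma>(1)])
  define g where "g n = (cmod (complex_of_real (f n) - P n))\<^sup>2" for n
  define v where "v n = (cmod (P n - A n))\<^sup>2" for n
  have tP: "texp P" by (rule texp_trig_poly[OF P(1)])
  have "texp (\<lambda>n. (P n - A n) * cnj (P n - A n))"
    by (intro texp_mult texp_cnj texp_diff tP A)
  then have tv: "texp (\<lambda>n. complex_of_real (v n))"
    unfolding v_def complex_norm_square .
  have bg: "bounded (range g)"
  proof -
    obtain M1 M2 where "\<And>n. \<bar>f n\<bar> \<le> M1" "\<And>n. cmod (P n) \<le> M2"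
      using f(2) texp_bounded[OF tP] by (auto simp: bounded_range_real_iff)
    then have "cmod (complex_of_real (f n) - P n) \<le> M1 + M2" for n
      by (metis add_mono norm_of_real norm_triangle_ineq4 order_trans)
    then have "\<bar>g n\<bar> \<le> (M1 + M2)\<^sup>2" for n by (simp add: g_def power_mono)
    then show ?thesis by (rule bounded_range_realI)
  qed
  have Lg: "L g \<le> \<gamma>" using P(2) by (intro L_le bg) (simp add: g_def[abs_def])
  have uni: "\<forall>\<^sub>F N in sequentially. \<forall>m. cmod (avg \<Phi> (\<lambda>n. complex_of_real (v (n + m))) N - avg \<Phi> (\<lambda>n. complex_of_real (v n)) N) \<le> s"
    by (rule texp_avg_shift_uniform[OF F tv s])
  from P(2) A(2) uni show ?thesis
  proof eventually_elim
    case (elim N)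
    \<comment> \<open>The mean squared distance of \<open>f\<close> to \<open>P\<close> over the
      \<open>N\<close>-th set translated by \<open>m\<close>. By shift invariance its mean over
      \<open>m\<close> is \<open>L g\<close>, whatever \<open>N\<close> is.\<close>
    define X where "X m = avg \<Phi> (\<lambda>n. g (n + m)) N" for m
    have bX: "bounded (range X)" and LX: "L X = L g"
    proof -
      have b: "bounded (range (\<lambda>m. g (n + m)))" for n
        using bounded_range_shift[OF bg, of n] by (simp add: add.commute)
      show "bounded (range X)" unfolding X_def by (rule L_avg(2)[OF b])
      have "L X = avg \<Phi> (\<lambda>n. L (\<lambda>m. g (n + m))) N" unfolding X_def by (rule L_avg(1)[OF b])
      also have "\<dots> = avg \<Phi> (\<lambda>n. L g) N" using L_shift[OF bg] by (simp add: add.commute)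
      finally show "L X = L g" by (simp add: avg_const[OF F])
    qed
    have gA: "avg \<Phi> (\<lambda>n. (cmod (complex_of_real (f n) - A n))\<^sup>2) N \<le> s" and gP: "avg \<Phi> g N \<le> s"
      using elim \<gamma> by (simp_all add: g_def[abs_def])
    have "avg \<Phi> v N \<le> avg \<Phi> (\<lambda>n. 2 * g n + 2 * (cmod (complex_of_real (f n) - A n))\<^sup>2) N"
    proof (rule avg_mono)
      fix n
      have "(cmod (P n - A n))\<^sup>2 \<le> (cmod (complex_of_real (f n) - P n) + cmod (complex_of_real (f n) - A n))\<^sup>2"
        using norm_triangle_ineq[of "P n - complex_of_real (f n)" "complex_of_real (f n) - A n"]
        by (intro power_mono) (simp_all add: norm_minus_commute)
      also have "\<dots> \<le> 2 * g n + 2 * (cmod (complex_of_real (f n) - A n))\<^sup>2"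
        using sum_squares_bound[of "cmod (complex_of_real (f n) - P n)" "cmod (complex_of_real (f n) - A n)"]
        by (simp add: power2_sum g_def)
      finally show "v n \<le> 2 * g n + 2 * (cmod (complex_of_real (f n) - A n))\<^sup>2" by (simp add: v_def)
    qed
    then have v0: "avg \<Phi> v N \<le> 4 * s" using gA gP by (simp add: avg_add avg_scale)
    have vm: "avg \<Phi> (\<lambda>n. v (n + m)) N \<le> 5 * s" for m
    proof -
      have "\<bar>avg \<Phi> (\<lambda>n. v (n + m)) N - avg \<Phi> v N\<bar> \<le> s"
        using elim(3) unfolding avg_of_real by (metis norm_of_real of_real_diff)
      with v0 show ?thesis by linarith
    qed
    \<comment> \<open>Go from \<open>f (n + m)\<close> through \<open>P (n + m)\<close>,
      \<open>A (n + m)\<close> and \<open>A n\<close> to \<open>f n\<close>. If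
      \<open>X m \<le> s\<close>, the four squares average to at most \<open>s\<close>,
      \<open>5 * s\<close>, \<open>s\<close> and \<open>s\<close>, and four times their sum is
      \<open>32 * s\<close>.\<close>
    have "X m > s" if m: "m \<in> W" and D: "avg \<Phi> (\<lambda>n. (f (n + m) - f n)\<^sup>2) N > 32 * s" for m
    proof (rule ccontr)
      assume "\<not> X m > s"
      have "avg \<Phi> (\<lambda>n. (f (n + m) - f n)\<^sup>2) N
        \<le> avg \<Phi> (\<lambda>n. 4 * (((g (n + m) + v (n + m)) + s) + (cmod (complex_of_real (f n) - A n))\<^sup>2)) N"
      proof (rule avg_mono)
        fix n
        have "(f (n + m) - f n)\<^sup>2 = (cmod ((complex_of_real (f (n + m)) - P (n + m)) + (P (n + m) - A (n + m))
            + (A (n + m) - A n) + (A n - complex_of_real (f n))))\<^sup>2"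
          by (simp flip: of_real_diff)
        also have "\<dots> \<le> 4 * ((cmod (complex_of_real (f (n + m)) - P (n + m)))\<^sup>2 + (cmod (P (n + m) - A (n + m)))\<^sup>2
            + (cmod (A (n + m) - A n))\<^sup>2 + (cmod (A n - complex_of_real (f n)))\<^sup>2)"
          by (rule cmod_sum4_sq)
        also have "\<dots> \<le> 4 * (((g (n + m) + v (n + m)) + s) + (cmod (complex_of_real (f n) - A n))\<^sup>2)"
          using W[OF m, of n] by (simp add: g_def v_def norm_minus_commute)
        finally show "(f (n + m) - f n)\<^sup>2 \<le> 4 * (((g (n + m) + v (n + m)) + s) + (cmod (complex_of_real (f n) - A n))\<^sup>2)" .
      qed
      also have "\<dots> = 4 * (X m + avg \<Phi> (\<lambda>n. v (n + m)) N + s + avg \<Phi> (\<lambda>n. (cmod (complex_of_real (f n) - A n))\<^sup>2) N)"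
        by (simp only: avg_scale avg_add avg_const[OF F] X_def)
      also have "\<dots> \<le> 4 * (s + 5 * s + s + s)" using vm[of m] gA \<open>\<not> X m > s\<close> by simp
      finally show False using D by simp
    qed
    moreover have X0: "X m \<ge> 0" for m unfolding X_def by (rule avg_nonneg) (simp add: g_def)
    ultimately have "indicator {m\<in>W. avg \<Phi> (\<lambda>n. (f (n + m) - f n)\<^sup>2) N > 32 * s} m \<le> inverse s * X m" for m
      using s by (auto simp: indicator_def field_simps less_imp_le)
    then have "L (indicator {m\<in>W. avg \<Phi> (\<lambda>n. (f (n + m) - f n)\<^sup>2) N > 32 * s}) \<le> L (\<lambda>m. inverse s * X m)"
      by (intro mono bounded_range_indicator bounded_range_mult bounded_range_const bX)
    also have "\<dots> \<le> inverse s * \<gamma>" using s Lg by (simp add: scale[OF bX] LX)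
    also have "\<dots> < \<kappa>" using \<gamma>(3) s by (simp add: field_simps)
    finally show ?case .
  qed
qed

end

section \<open>Choice of the ultrafilter\<close>

text \<open>The shift by \<open>m\<close> changes each character by the factor
  \<open>cis (a j * m)\<close>, whose squared distance to 1 is \<open>2 - 2 * cos (a j * m)\<close>,
  hence at most \<open>2 * \<eta>\<close>.\<close>

lemma trig_poly_almost_periods:
  assumes P: "trig_poly P" and s: "s > 0"
  shows "\<exists>(J::nat) a \<eta>. 0 < \<eta> \<and> \<eta> \<le> 1 \<and>
    (\<forall>m n. (\<forall>j<J. cos (a j * real m) > 1 - \<eta>) \<longrightarrow> (cmod (P (n + m) - P n))\<^sup>2 \<le> s)"
proof -
  obtain J c \<theta> where P: "P = (\<lambda>n. \<Sum>j<(J::nat). c j * exp (2 * pi * \<i> * complex_of_real (\<theta> j) * of_nat n))"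
    using P unfolding trig_poly_def by blast
  define a where "a j = 2 * pi * \<theta> j" for j
  have P: "P n = (\<Sum>j<J. c j * cis (a j * real n))" for n
    unfolding P by (simp add: a_def cis_conv_exp mult_ac)
  define C where "C = (\<Sum>j<J. cmod (c j))"
  \<comment> \<open>Ensures \<open>C\<^sup>2 * (2 * \<eta>) \<le> s\<close>; adding 1 to
    \<open>C\<^sup>2\<close> avoids division by zero, and the cap 1 makes cosines above
    \<open>1 - \<eta>\<close> positive.\<close>
  define \<eta> where "\<eta> = min 1 (s / (2 * (C\<^sup>2 + 1)))"
  have C1: "C\<^sup>2 + 1 > 0" by (simp add: add_nonneg_pos)
  have C0: "C \<ge> 0" by (simp add: C_def sum_nonneg)
  have \<eta>: "0 < \<eta>" "\<eta> \<le> 1" using s C1 by (simp_all add: \<eta>_def)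
  have "\<eta> \<le> s / (2 * (C\<^sup>2 + 1))" by (simp add: \<eta>_def)
  then have "\<eta> * (2 * (C\<^sup>2 + 1)) \<le> s" using C1 by (simp add: pos_le_divide_eq)
  then have C\<eta>: "C\<^sup>2 * (2 * \<eta>) \<le> s" using \<eta> by (simp add: algebra_simps)
  have "(cmod (P (n + m) - P n))\<^sup>2 \<le> s" if m: "\<forall>j<J. cos (a j * real m) > 1 - \<eta>" for m n
  proof -
    have le: "cmod (cis (a j * real m) - 1) \<le> sqrt (2 * \<eta>)" if "j < J" for j
    proof -
      have "(cmod (cis (a j * real m) - 1))\<^sup>2 = (cos (a j * real m))\<^sup>2 + (sin (a j * real m))\<^sup>2 + 1 - 2 * cos (a j * real m)"
        by (simp add: cmod_power2 power2_diff)
      also have "\<dots> = 2 - 2 * cos (a j * real m)" by simp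
      also have "\<dots> \<le> 2 * \<eta>" using m that by fastforce
      finally show ?thesis by (rule real_le_rsqrt)
    qed
    have "P (n + m) - P n = (\<Sum>j<J. c j * (cis (a j * real n) * (cis (a j * real m) - 1)))"
      unfolding P by (simp add: distrib_left right_diff_distrib sum_subtractf flip: cis_mult)
    also have "cmod \<dots> \<le> (\<Sum>j<J. cmod (c j) * sqrt (2 * \<eta>))"
      by (rule sum_norm_le) (simp add: norm_mult mult_left_mono le)
    also have "\<dots> = C * sqrt (2 * \<eta>)" by (simp add: C_def sum_distrib_right)
    finally have "(cmod (P (n + m) - P n))\<^sup>2 \<le> (C * sqrt (2 * \<eta>))\<^sup>2"
      by (rule power_mono) simp
    also have "\<dots> = C\<^sup>2 * (2 * \<eta>)" using \<eta> by (simp add: power_mult_distrib)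
    finally show ?thesis using C\<eta> by simp
  qed
  with \<eta> show ?thesis by blast
qed

lemma upper_density_null:
  assumes "\<not> upper_density \<Psi> E > 0"
  shows "(\<lambda>k. real (card (E \<inter> \<Psi> k)) / real (card (\<Psi> k))) \<longlonglongrightarrow> 0"
proof (rule tendstoI)
  fix e :: real assume "e > 0"
  then have "limsup (\<lambda>k. ereal (real (card (E \<inter> \<Psi> k)) / real (card (\<Psi> k)))) < ereal e"
    using assms by (simp add: upper_density_def not_less) (metis ereal_less(2) le_less_trans)
  from Limsup_lessD[OF this]
  show "\<forall>\<^sub>F k in sequentially. dist (real (card (E \<inter> \<Psi> k)) / real (card (\<Psi> k))) 0 < e"
    by eventually_elim (simp add: dist_norm)
qed

text \<open>The sets \<open>E i - Z\<close> with \<open>Z\<close> of density zero along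
  \<open>\<Psi>\<close> generate a proper filter, as the lower bound \<open>c\<close> prevents
  \<open>E i\<close> from lying inside such a \<open>Z\<close>. An ultrafilter below it contains the
  complement of every null set, so none of its members is null.\<close>

lemma positive_density_ultrafilter:
  fixes \<Psi> :: "nat \<Rightarrow> nat set"
  assumes fin: "\<And>k. finite (\<Psi> k)" and E: "decseq E"
    and pos: "\<And>i. \<exists>c>0. \<forall>\<^sub>F k in sequentially. c \<le> real (card (E i \<inter> \<Psi> k)) / real (card (\<Psi> k))"
  obtains p where "ultrafilter p" "\<And>i. \<forall>\<^sub>F m in p. m \<in> E i"
    "\<And>X. \<forall>\<^sub>F m in p. m \<in> X \<Longrightarrow> upper_density \<Psi> X > 0"
proof -
  define dens where "dens X k = real (card (X \<inter> \<Psi> k)) / real (card (\<Psi> k))" for X k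
  define null where "null = {Z. dens Z \<longlonglongrightarrow> 0}"
  have dens_mono: "dens X k \<le> dens Y k" if "X \<subseteq> Y" for X Y k
    unfolding dens_def using fin that by (intro divide_right_mono of_nat_mono card_mono) auto
  have dens_nonneg: "dens X k \<ge> 0" for X k by (simp add: dens_def)
  have null_Un: "Y \<union> Z \<in> null" if "Y \<in> null" "Z \<in> null" for Y Z
  proof -
    have "dens (Y \<union> Z) k \<le> dens Y k + dens Z k" for k
    proof -
      have "card ((Y \<union> Z) \<inter> \<Psi> k) \<le> card (Y \<inter> \<Psi> k) + card (Z \<inter> \<Psi> k)"
        by (simp add: Int_Un_distrib2 card_Un_le)
      then have "real (card ((Y \<union> Z) \<inter> \<Psi> k)) \<le> real (card (Y \<inter> \<Psi> k)) + real (card (Z \<inter> \<Psi> k))"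
        by (simp only: of_nat_le_iff flip: of_nat_add)
      then show ?thesis
        unfolding dens_def by (simp only: divide_right_mono of_nat_0_le_iff flip: add_divide_distrib)
    qed
    moreover have "(\<lambda>k. dens Y k + dens Z k) \<longlonglongrightarrow> 0"
      using tendsto_add[of "dens Y" 0 _ "dens Z" 0] that by (simp add: null_def)
    ultimately have "dens (Y \<union> Z) \<longlonglongrightarrow> 0"
      by (intro tendsto_sandwich[of "\<lambda>_. 0" "dens (Y \<union> Z)" _ "\<lambda>k. dens Y k + dens Z k"])
         (auto simp: dens_nonneg)
    then show ?thesis by (simp add: null_def)
  qed
  have empty: "{} \<in> null" by (simp add: null_def dens_def[abs_def])
  \<comment> \<open>The generators are directed, since the \<open>E i\<close> decrease and null sets
    are closed under union; properness thus reduces to nonempty generators.\<close>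
  define G where "G = (INF x\<in>(UNIV :: nat set) \<times> null. principal (E (fst x) - snd x))"
  have "eventually (\<lambda>m. False) G \<longleftrightarrow> (\<exists>x\<in>UNIV \<times> null. eventually (\<lambda>m. False) (principal (E (fst x) - snd x)))"
    unfolding G_def
  proof (rule eventually_INF_base)
    show "UNIV \<times> null \<noteq> {}" using empty by auto
    fix x y :: "nat \<times> nat set" assume "x \<in> UNIV \<times> null" "y \<in> UNIV \<times> null"
    then show "\<exists>z\<in>UNIV \<times> null. principal (E (fst z) - snd z)
        \<le> inf (principal (E (fst x) - snd x)) (principal (E (fst y) - snd y))"
      using decseqD[OF E, of "fst x" "max (fst x) (fst y)"] decseqD[OF E, of "fst y" "max (fst x) (fst y)"]
      by (intro bexI[of _ "(max (fst x) (fst y), snd x \<union> snd y)"]) (auto simp: null_Un)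
  qed
  moreover have "\<not> E i \<subseteq> Z" if "Z \<in> null" for i Z
  proof
    assume sub: "E i \<subseteq> Z"
    obtain c where c: "c > 0" "\<forall>\<^sub>F k in sequentially. c \<le> dens (E i) k" using pos by (auto simp: dens_def)
    have "\<forall>\<^sub>F k in sequentially. dens Z k < c"
      using that c(1) by (intro order_tendstoD(2)[of "dens Z" 0]) (simp_all add: null_def)
    with c(2) have "\<forall>\<^sub>F k in sequentially. False"
      by eventually_elim (use dens_mono[OF sub] in \<open>metis leD order_trans\<close>)
    then show False by simp
  qed
  ultimately have "G \<noteq> bot" by (auto simp: trivial_limit_def eventually_principal)
  then obtain p where p: "ultrafilter p" "p \<le> G" by (rule ultrafilter_refines)
  have le: "\<forall>\<^sub>F m in p. m \<in> E i - Z" if "Z \<in> null" for i Z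
  proof -
    have "G \<le> principal (E i - Z)" unfolding G_def using that by (intro INF_lower2[of "(i, Z)"]) auto
    then show ?thesis using p(2) by (metis le_principal order_trans)
  qed
  show thesis
  proof (rule that[OF p(1)])
    show "\<forall>\<^sub>F m in p. m \<in> E i" for i using le[OF empty, of i] by simp
    show "upper_density \<Psi> X > 0" if X: "\<forall>\<^sub>F m in p. m \<in> X" for X
    proof (rule ccontr)
      assume "\<not> upper_density \<Psi> X > 0"
      then have "X \<in> null" using upper_density_null by (simp add: null_def dens_def[abs_def])
      from le[OF this, of 0] X have "\<forall>\<^sub>F m in p. False" by eventually_elim simp
      then show False using p(1) by (simp add: ultrafilter_def)
    qed
  qed
qed

lemma ushift_tendsto:
  assumes "ultrafilter p" "bounded (range f)"
  shows "((\<lambda>m. f (n + m)) \<longlongrightarrow> ushift p f n) p"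
  unfolding ushift_def
  by (rule ultrafilter_tendsto_bounded[OF assms(1)])
     (use assms(2) in \<open>auto simp: bounded_range_real_iff\<close>)

lemma tendsto_avg:
  assumes "\<And>n. ((\<lambda>m. u n m) \<longlongrightarrow> l n) p"
  shows "((\<lambda>m. avg \<Phi> (\<lambda>n. u n m) N) \<longlongrightarrow> (avg \<Phi> l N :: real)) p"
  unfolding avg_def divide_inverse by (intro tendsto_intros assms)

section \<open>Construction of the subsequence and the ultrafilter\<close>

theorem theorem4p1:
  fixes \<epsilon> :: real and \<Phi> :: "nat \<Rightarrow> nat set"
    and fBes fanti fc :: "nat \<Rightarrow> real"
  assumes "\<epsilon> > 0" and "folner \<Phi>"
    and "(\<lambda>n. complex_of_real (fBes n)) \<in> Bes \<Phi>" and "bounded (range fBes)" and "\<forall>n. fBes n \<ge> 0"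
    and "(\<lambda>n. complex_of_real (fanti n)) \<in> Bes_perp \<Phi>" and "bounded (range fanti)"
    and "(\<lambda>n. complex_of_real (fc n)) \<in> L2 \<Phi>" and "bounded (range fc)" and "\<forall>n. fc n \<ge> 0"
    and "compact_along \<Phi> (\<lambda>n. complex_of_real (fc n))"
  shows "\<exists>\<Psi> p. subseq_of \<Psi> \<Phi> \<and> ultrafilter p \<and>
     (\<forall>E. eventually (\<lambda>n. n \<in> E) p \<longrightarrow> upper_density \<Psi> E > 0) \<and>
     eventually (\<lambda>n. n \<in> {n. phinorm \<Psi> (\<lambda>k. complex_of_real (shift n fc k - fc k)) < ereal (\<epsilon> / 3)}) p \<and>
     phinorm \<Psi> (\<lambda>k. complex_of_real (ushift p fBes k - fBes k)) < ereal (\<epsilon> / 3) \<and>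
     (\<exists>L\<ge>0. avg \<Psi> (\<lambda>k. fc k * ushift p fanti k) \<longlonglongrightarrow> L)"
proof -
  note F = assms(2)
  \<comment> \<open>The final squared error is \<open>32 * s\<close>, and 32/400 < 1/9.\<close>
  define s where "s = \<epsilon>\<^sup>2 / 400"
  have s: "s > 0" and \<epsilon>3: "\<epsilon> / 3 > 0" using assms(1) by (simp_all add: s_def)
  obtain q where q: "ultrafilter q" "q \<le> sequentially" by (rule exists_nonprincipal_ultrafilter)
  interpret folner_mean \<Phi> q by unfold_locales (use F q in auto)
  obtain T where T: "trig_poly T"
    "\<forall>\<^sub>F N in sequentially. avg \<Phi> (\<lambda>n. (cmod (complex_of_real (fBes n) - T n))\<^sup>2) N \<le> s"
    by (rule Bes_approx[OF assms(3) s])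
  obtain J1 :: nat and \<theta> where ret: "\<forall>r. (\<forall>j<J1. cos (real r * (2 * pi * \<theta> j)) > 0) \<longrightarrow>
       phinorm \<Phi> (\<lambda>n. complex_of_real (fc (n + r) - fc n)) < ereal (\<epsilon> / 3)"
    using compact_returns_Bohr[OF F assms(9) assms(11) \<epsilon>3] by blast
  obtain J2 :: nat and b \<eta> where \<eta>: "0 < \<eta>" "\<eta> \<le> 1"
    and per: "\<And>m n. \<forall>j<J2. cos (b j * real m) > 1 - \<eta> \<Longrightarrow> (cmod (T (n + m) - T n))\<^sup>2 \<le> s"
    using trig_poly_almost_periods[OF T(1) s] by blast
  \<comment> \<open>The two frequency lists are joined, so that a single weight controls the returns
    of \<open>fc\<close> and the almost periods of \<open>T\<close>.\<close>
  define a where "a j = (if j < J1 then 2 * pi * \<theta> j else b (j - J1))" for j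
  define w where "w = bohr_weight (J1 + J2) a \<eta>"
  have w: "\<And>m. 0 \<le> w m" "\<And>m. w m \<le> \<eta>" "bounded (range w)"
    using \<eta> by (auto simp: w_def bohr_weight_nonneg bohr_weight_le bounded_bohr_weight)
  have w_cos: "cos (a j * real m) > 1 - \<eta>" if "w m > 0" "j < J1 + J2" for m j
    using bohr_weight_posD that unfolding w_def by blast
  have w_ret: "phinorm \<Phi> (\<lambda>n. complex_of_real (fc (n + m) - fc n)) < ereal (\<epsilon> / 3)" if "w m > 0" for m
  proof -
    have "cos (real m * (2 * pi * \<theta> j)) > 0" if "j < J1" for j
      using w_cos[OF \<open>w m > 0\<close>, of j] that \<eta> by (simp add: a_def mult_ac)
    then show ?thesis using ret by blast
  qed
  have w_per: "(cmod (T (n + m) - T n))\<^sup>2 \<le> s" if "w m > 0" for m n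
  proof (rule per, intro allI impI)
    fix j assume "j < J2"
    then show "cos (b j * real m) > 1 - \<eta>" using w_cos[OF that, of "J1 + j"] by (simp add: a_def)
  qed
  define A where "A N m = avg \<Phi> (\<lambda>n. fc n * fanti (n + m)) N" for N m
  define D where "D N m = avg \<Phi> (\<lambda>n. (fBes (n + m) - fBes n)\<^sup>2) N" for N m
  \<comment> \<open>Zeros of \<open>w\<close> contribute nothing to \<open>\<Lambda>\<close>;
    putting them into \<open>B N\<close> forces every selected shift to have positive
    weight.\<close>
  define B where "B N = {m. w m = 0 \<or> D N m > 32 * s}" for N
  obtain Mc Ma where M: "\<And>n. \<bar>fc n\<bar> \<le> Mc" "\<And>n. \<bar>fanti n\<bar> \<le> Ma"
    using assms(7,9) by (auto simp: bounded_range_real_iff)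
  have A_bound: "\<bar>A N m\<bar> \<le> Mc * Ma" for N m
  proof -
    have "norm (fc n * fanti (n + m)) \<le> Mc * Ma" for n
      unfolding real_norm_def abs_mult using M[of n] M[of "n + m"] by (intro mult_mono') auto
    then have "norm (avg \<Phi> (\<lambda>n. fc n * fanti (n + m)) N) \<le> Mc * Ma" by (rule norm_avg_le[OF F])
    then show ?thesis by (simp add: A_def)
  qed
  define \<Lambda> where "\<Lambda> u = L (\<lambda>m. w m * u m)" for u
  have pf: "positive_functional \<Lambda>"
    unfolding \<Lambda>_def by (rule positive_functional_weighted[OF positive_functional_axioms w(3,1)])
  have \<Lambda>_le: "\<Lambda> (indicator X) \<le> \<eta> * L (indicator Y)" if "\<And>m. w m > 0 \<Longrightarrow> m \<in> X \<Longrightarrow> m \<in> Y" for X Y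
  proof -
    have "w m * indicator X m \<le> \<eta> * indicator Y m" for m
      using that[of m] w(1)[of m] w(2)[of m] \<eta> by (cases "w m = 0") (auto simp: indicator_def)
    then have "\<Lambda> (indicator X) \<le> L (\<lambda>m. \<eta> * indicator Y m)"
      unfolding \<Lambda>_def by (intro mono bounded_range_intros w(3))
    then show ?thesis by (simp add: scale bounded_range_indicator)
  qed
  interpret av: averaged_family \<Lambda> q A "Mc * Ma" B
  proof (intro averaged_family.intro averaged_family_axioms.intro pf)
    show "ultrafilter q" by fact
    show "\<bar>A N m\<bar> \<le> Mc * Ma" for N m by (rule A_bound)
    show "\<Lambda> (A N) = 0" for N
    proof -
      have b: "bounded (range (\<lambda>m. w m * fanti (m + n)))" for n
        by (intro bounded_range_mult w(3) bounded_range_shift assms(7))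
      have bn: "bounded (range (\<lambda>m. fc n * (w m * fanti (m + n))))" for n
        by (intro bounded_range_mult bounded_range_const b)
      \<comment> \<open>The mean over shifts moves inside the finite average over \<open>n\<close>,
        where each term vanishes by orthogonality of the weight to the shifts of
        \<open>fanti\<close>.\<close>
      have "\<Lambda> (A N) = L (\<lambda>m. avg \<Phi> (\<lambda>n. fc n * (w m * fanti (m + n))) N)"
        by (simp add: \<Lambda>_def A_def mult.left_commute add.commute flip: avg_scale)
      also have "\<dots> = avg \<Phi> (\<lambda>n. L (\<lambda>m. fc n * (w m * fanti (m + n)))) N" by (rule L_avg(1)[OF bn])
      also have "(\<lambda>n. L (\<lambda>m. fc n * (w m * fanti (m + n)))) = (\<lambda>n. 0)"
      proof
        fix n
        have "L (\<lambda>m. fc n * (w m * fanti (m + n))) = fc n * L (\<lambda>m. w m * fanti (m + n))"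
          by (rule scale[OF b])
        then show "L (\<lambda>m. fc n * (w m * fanti (m + n))) = 0"
          using L_bohr_weight_perp[OF assms(6,7)] by (simp add: w_def)
      qed
      finally show ?thesis by (simp add: avg_def)
    qed
    show "\<forall>\<^sub>F N in q. \<Lambda> (indicator (B N)) < \<kappa>" if "\<kappa> > 0" for \<kappa>
    proof -
      have "\<kappa> / \<eta> > 0" using that \<eta> by simp
      from exceptional_mass[OF assms(3,4) s texp_trig_poly[OF T(1)] T(2), of "{m. w m > 0}" "\<kappa> / \<eta>"] w_per this
      have "\<forall>\<^sub>F N in sequentially. L (indicator {m \<in> {m. w m > 0}. D N m > 32 * s}) < \<kappa> / \<eta>"
        by (simp add: D_def)
      then have "\<forall>\<^sub>F N in sequentially. \<Lambda> (indicator (B N)) < \<kappa>"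
      proof eventually_elim
        case (elim N)
        have "\<Lambda> (indicator (B N)) \<le> \<eta> * L (indicator {m \<in> {m. w m > 0}. D N m > 32 * s})"
          by (rule \<Lambda>_le) (auto simp: B_def)
        also have "\<dots> < \<kappa>" using elim \<eta> by (simp add: field_simps)
        finally show ?case .
      qed
      then show ?thesis by (rule filter_leD[OF q(2)])
    qed
    show "\<Lambda> (\<lambda>_. 1) > 0" using L_bohr_weight_pos[OF \<eta>(1)] by (simp add: \<Lambda>_def w_def)
  qed
  define dens where "dens X N = real (card (X \<inter> \<Phi> N)) / real (card (\<Phi> N))" for X N
  have dens: "avg \<Phi> (indicator X) N = dens X N" for X N
    using folner_finite[OF F, of N] by (simp add: avg_def dens_def sum.inter_filter[symmetric] indicator_def Int_def conj_commute)
  \<comment> \<open>As \<open>w \<le> \<eta>\<close>, the mean of the indicator is at least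
    \<open>2 * \<beta> X\<close>; for positive mass the densities of \<open>X\<close> therefore
    exceed \<open>\<beta> X\<close> along \<open>q\<close>.\<close>
  define \<beta> where "\<beta> X = \<Lambda> (indicator X) / (2 * \<eta>)" for X
  have large: "\<forall>\<^sub>F N in q. N \<in> {N. \<beta> X < dens X N}" if "\<Lambda> (indicator X) > 0" for X
  proof -
    have "\<Lambda> (indicator X) \<le> \<eta> * L (indicator X)" by (rule \<Lambda>_le)
    then have "\<beta> X < L (indicator X)" using that \<eta> by (simp add: \<beta>_def field_simps)
    then show ?thesis
      using order_tendstoD(1)[OF tendsto_L[OF bounded_range_indicator]] by (simp add: dens)
  qed
  obtain E N where E: "decseq E" and N: "strict_mono N" and ne: "\<And>i. \<Lambda> (indicator (E i)) > 0"
    and Ndens: "\<And>i k. i < k \<Longrightarrow> N k \<in> {N. \<beta> (E i) < dens (E i) N}"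
    and EA: "\<And>i m. m \<in> E i \<Longrightarrow> A (N i) m \<ge> - inverse (real (Suc i)) \<and> m \<notin> B (N i)"
    and osc: "\<And>i m m'. m \<in> E i \<Longrightarrow> m' \<in> E i \<Longrightarrow> \<bar>A (N i) m - A (N i) m'\<bar> \<le> inverse (real (Suc i))"
    by (rule av.selection[where Qf = "\<lambda>X. {N. \<beta> X < dens X N}", OF large q(2)]) (assumption, rule that)
  \<comment> \<open>A sample point in each set: by \<open>osc\<close>, its value represents
    \<open>A (N i)\<close> on all of \<open>E i\<close> up to
    \<open>inverse (Suc i)\<close>.\<close>
  define pt where "pt i = (SOME m. m \<in> E i)" for i
  have pt: "pt i \<in> E i" for i
    unfolding pt_def using av.mass_pos_nonempty[OF ne[of i]] by (rule some_in_eq[THEN iffD2])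
  define v where "v i = A (N i) (pt i)" for i
  have "bounded (range v)" using A_bound by (intro bounded_range_realI) (simp add: v_def)
  then obtain l r where r: "strict_mono r" and l: "(v \<circ> r) \<longlonglongrightarrow> l"
    using bounded_imp_convergent_subsequence by blast
  have inv0: "(\<lambda>k. inverse (real (Suc (r k)))) \<longlonglongrightarrow> 0"
    using LIMSEQ_subseq_LIMSEQ[OF LIMSEQ_inverse_real_of_nat r] by (simp add: comp_def)
  have "l \<ge> 0"
  proof (rule LIMSEQ_le)
    show "(\<lambda>k. - inverse (real (Suc (r k)))) \<longlonglongrightarrow> 0" using tendsto_minus[OF inv0] by simp
    show "(v \<circ> r) \<longlonglongrightarrow> l" by fact
    show "\<exists>K. \<forall>k\<ge>K. - inverse (real (Suc (r k))) \<le> (v \<circ> r) k" using EA[OF pt] by (simp add: v_def)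
  qed
  define \<sigma> where "\<sigma> = N \<circ> r"
  have \<sigma>: "strict_mono \<sigma>" unfolding \<sigma>_def by (rule strict_mono_o[OF N r])
  define \<Psi> where "\<Psi> = \<Phi> \<circ> \<sigma>"
  have avg_\<Psi>: "avg \<Psi> u k = avg \<Phi> u (\<sigma> k)" for u :: "nat \<Rightarrow> real" and k
    by (simp add: avg_def \<Psi>_def)
  \<comment> \<open>\<open>Ndens\<close> concerns indices later than \<open>i\<close>; these are
    reached for \<open>k > i\<close>, because \<open>r k \<ge> k\<close>.\<close>
  have pos: "\<exists>c>0. \<forall>\<^sub>F k in sequentially. c \<le> real (card (E i \<inter> \<Psi> k)) / real (card (\<Psi> k))" for i
  proof -
    have \<beta>: "\<beta> (E i) > 0" using ne \<eta> by (simp add: \<beta>_def)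
    have "\<beta> (E i) \<le> real (card (E i \<inter> \<Psi> k)) / real (card (\<Psi> k))" if "k > i" for k
    proof -
      have "i < r k" using that seq_suble[OF r, of k] by simp
      from Ndens[OF this] show ?thesis by (simp add: \<Psi>_def \<sigma>_def dens_def)
    qed
    then have "\<forall>\<^sub>F k in sequentially. \<beta> (E i) \<le> real (card (E i \<inter> \<Psi> k)) / real (card (\<Psi> k))"
      by (rule eventually_mono[OF eventually_gt_at_top[of i]])
    with \<beta> show ?thesis by blast
  qed
  have fin: "finite (\<Psi> k)" for k using folner_finite[OF F] by (simp add: \<Psi>_def)
  obtain p where p: "ultrafilter p" "\<And>i. \<forall>\<^sub>F m in p. m \<in> E i"
    "\<And>X. \<forall>\<^sub>F m in p. m \<in> X \<Longrightarrow> upper_density \<Psi> X > 0"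
    by (rule positive_density_ultrafilter[OF fin E pos]) (rule that)
  have p0: "p \<noteq> bot" using p(1) by (simp add: ultrafilter_def)
  have "subseq_of \<Psi> \<Phi>" using \<sigma> by (auto simp: subseq_of_def \<Psi>_def)
  moreover have "\<forall>\<^sub>F n in p. n \<in> {n. phinorm \<Psi> (\<lambda>k. complex_of_real (shift n fc k - fc k)) < ereal (\<epsilon> / 3)}"
    using p(2)[of 0]
  proof eventually_elim
    case (elim m)
    \<comment> \<open>\<open>E 0\<close> avoids \<open>B (N 0)\<close>, so it consists of shifts of
      positive weight, all of them return times of \<open>fc\<close>.\<close>
    then have "w m > 0" using EA[of m 0] w(1)[of m] by (auto simp: B_def less_le)
    from w_ret[OF this] obtain c where "c < (\<epsilon> / 3)\<^sup>2"
      "\<forall>\<^sub>F N in sequentially. avg \<Phi> (\<lambda>n. (cmod (complex_of_real (fc (n + m) - fc n)))\<^sup>2) N \<le> c"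
      unfolding phinorm_less_iff[OF \<epsilon>3] by blast
    then show ?case
      using eventually_subseq[OF \<sigma>] by (simp add: phinorm_less_iff[OF \<epsilon>3] shift_def avg_\<Psi>) blast
  qed
  moreover have "phinorm \<Psi> (\<lambda>k. complex_of_real (ushift p fBes k - fBes k)) < ereal (\<epsilon> / 3)"
  proof -
    \<comment> \<open>The bound holds for each single \<open>k\<close>: \<open>E (r k)\<close>
      belongs to \<open>p\<close> and avoids \<open>B (\<sigma> k)\<close>, and a finite average
      commutes with the limit along \<open>p\<close>.\<close>
    have "avg \<Psi> (\<lambda>n. (ushift p fBes n - fBes n)\<^sup>2) k \<le> 32 * s" for k
    proof (rule tendsto_upperbound[OF _ _ p0])
      show "((\<lambda>m. D (\<sigma> k) m) \<longlongrightarrow> avg \<Psi> (\<lambda>n. (ushift p fBes n - fBes n)\<^sup>2) k) p"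
        unfolding D_def avg_\<Psi> by (intro tendsto_avg tendsto_intros ushift_tendsto p(1) assms(4))
      show "\<forall>\<^sub>F m in p. D (\<sigma> k) m \<le> 32 * s"
        using p(2)[of "r k"] by eventually_elim (use EA in \<open>fastforce simp: B_def \<sigma>_def\<close>)
    qed
    moreover have "32 * s < (\<epsilon> / 3)\<^sup>2" using assms(1) by (simp add: s_def power_divide)
    ultimately show ?thesis
      unfolding phinorm_less_iff[OF \<epsilon>3] norm_of_real power2_abs by (intro exI[of _ "32 * s"]) simp
  qed
  moreover have "avg \<Psi> (\<lambda>k. fc k * ushift p fanti k) \<longlonglongrightarrow> l"
  proof -
    \<comment> \<open>The average on the left is the limit of \<open>A (\<sigma> k) m\<close> along
      \<open>p\<close>; since \<open>E (r k)\<close> belongs to \<open>p\<close>, \<open>osc\<close>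
      compares it with the sample value, which tends to \<open>l\<close> along
      \<open>r\<close>.\<close>
    have "norm (avg \<Psi> (\<lambda>n. fc n * ushift p fanti n) k - (v \<circ> r) k) \<le> inverse (real (Suc (r k)))" for k
    proof (rule tendsto_upperbound[OF _ _ p0])
      show "((\<lambda>m. norm (A (\<sigma> k) m - (v \<circ> r) k)) \<longlongrightarrow> norm (avg \<Psi> (\<lambda>n. fc n * ushift p fanti n) k - (v \<circ> r) k)) p"
        unfolding A_def avg_\<Psi> by (intro tendsto_avg tendsto_intros ushift_tendsto p(1) assms(7))
      show "\<forall>\<^sub>F m in p. norm (A (\<sigma> k) m - (v \<circ> r) k) \<le> inverse (real (Suc (r k)))"
        using p(2)[of "r k"]
      proof eventually_elim
        case (elim m)
        from osc[OF this pt] show ?case by (simp add: v_def \<sigma>_def)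
      qed
    qed
    then have "(\<lambda>k. avg \<Psi> (\<lambda>n. fc n * ushift p fanti n) k - (v \<circ> r) k) \<longlonglongrightarrow> 0"
      by (intro Lim_null_comparison[OF _ inv0]) simp
    from tendsto_add[OF this l] show ?thesis by simp
  qed
  ultimately show ?thesis using p(1,3) \<open>l \<ge> 0\<close> by blast
qed

end
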